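(* Let $T:X\to X$ be a homeomorphism of a compact metric space $(X,d)$ with the specification property, let $\tau:X\to(0,\infty)$ be a continuous roof function, and let $(X_\tau,\Theta)$ be the corresponding suspension flow. Let $\Phi,H\in C(X_\tau)$. Then for every $\alpha\in\mathbb{R}$ with $K(\Phi,\alpha)\ne\emptyset$, $$\sup_{(x,s)\in K(\Phi,\alpha)}\limsup_{t\to\infty}\frac1t\int_0^t H(\theta_u(x,s))\,du=\sup\Big\{\int H\,d\nu:\nu\in\mathcal{M}_\Theta,\ \int\Phi\,d\nu=\alpha\Big\}=\sup\Big\{\int H\,d\nu:\nu\in\bigcup_{(x,s)\in K(\Phi,\alpha)}\mathcal{V}((x,s))\Big\}.$$
   Context: $(X,T)$ has the specification property if for every $\epsilon>0$ there is an integer $m(\epsilon)$ such that for any finite collection of intervals $[a_j,b_j]\subset\mathbb{N}$, $j=1,\dots,k$, with $a_{j+1}-b_j\ge m(\epsilon)$ for $j=1,\dots,k-1$, and any $x_1,\dots,x_k\in X$, there is $x\in X$ with $d(T^{p+a_j}x,T^px_j)<\epsilon$ for all $p=0,\dots,b_j-a_j$ and all $j$. The suspension space is $X_\tau=\{(x,s)\in X\times\mathbb{R}:0\le s\le\tau(x)\}$ with $(x,\tau(x))$ identified with $(Tx,0)$, equipped with the Bowen–Walters metric (making it compact); the suspension flow is $\theta_t(x,s)=(x,s+t)$ (with the identification). $\mathcal{M}_\Theta$ is the set of Borel probability measures on $X_\tau$ invariant under all $\theta_t$, $t\ge0$. $K(\Phi,\alpha)=\{(x,s)\in X_\tau:\lim_{t\to\infty}\frac1t\int_0^t\Phi(\theta_u(x,s))\,du=\alpha\}$.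 For $(x,s)\in X_\tau$, $\mathcal{V}((x,s))$ is the set of weak$^*$ limit points as $t\to\infty$ of $\delta_{(x,s),t}=\frac1t\int_0^t\delta_{\theta_u(x,s)}\,du$. *)

theory Defs
  imports "HOL-Probability.Probability"
begin

definition has_specification :: "'a::metric_space set \<Rightarrow> ('a \<Rightarrow> 'a) \<Rightarrow> bool" where
  "has_specification X T \<longleftrightarrow>
     (\<forall>\<epsilon>>0. \<exists>m::nat. \<forall>(k::nat) (a::nat \<Rightarrow> nat) (b::nat \<Rightarrow> nat) (xs::nat \<Rightarrow> 'a).
        (\<forall>j<k. a j \<le> b j \<and> xs j \<in> X) \<and> (\<forall>j. Suc j < k \<longrightarrow> b j + m \<le> a (Suc j)) \<longrightarrow>
        (\<exists>x\<in>X. \<forall>j<k. \<forall>p\<le>b j - a j. dist ((T ^^ (p + a j)) x) ((T ^^ p) (xs j)) < \<epsilon>))"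

text \<open>Fundamental domain: canonical representatives of points of X_tau.\<close>
definition susp_dom :: "'a set \<Rightarrow> ('a \<Rightarrow> real) \<Rightarrow> ('a \<times> real) set" where
  "susp_dom X \<tau> = {(x, s). x \<in> X \<and> 0 \<le> s \<and> s < \<tau> x}"

definition susp_closed :: "'a set \<Rightarrow> ('a \<Rightarrow> real) \<Rightarrow> ('a \<times> real) set" where
  "susp_closed X \<tau> = {(x, s). x \<in> X \<and> 0 \<le> s \<and> s \<le> \<tau> x}"

text \<open>Continuous functions on X_tau: continuous on the closed set and compatible with
  the identification (x, tau x) ~ (T x, 0).\<close>
definition susp_cont :: "'a::metric_space set \<Rightarrow> ('a \<Rightarrow> 'a) \<Rightarrow> ('a \<Rightarrow> real) \<Rightarrow> ('a \<times> real \<Rightarrow> real) \<Rightarrow> bool" where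
  "susp_cont X T \<tau> f \<longleftrightarrow> continuous_on (susp_closed X \<tau>) f \<and> (\<forall>x\<in>X. f (x, \<tau> x) = f (T x, 0))"

definition susp_flow :: "('a \<Rightarrow> 'a) \<Rightarrow> ('a \<Rightarrow> real) \<Rightarrow> real \<Rightarrow> 'a \<times> real \<Rightarrow> 'a \<times> real" where
  "susp_flow T \<tau> t p =
     (let x = fst p; r = snd p + t;
          n = (LEAST n. r < (\<Sum>i<Suc n. \<tau> ((T ^^ i) x)))
      in ((T ^^ n) x, r - (\<Sum>i<n. \<tau> ((T ^^ i) x))))"

definition birk_avg :: "('a \<Rightarrow> 'a) \<Rightarrow> ('a \<Rightarrow> real) \<Rightarrow> ('a \<times> real \<Rightarrow> real) \<Rightarrow> 'a \<times> real \<Rightarrow> real \<Rightarrow> real" where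
  "birk_avg T \<tau> f p t = (1 / t) * integral {0..t} (\<lambda>u. f (susp_flow T \<tau> u p))"

definition level_set :: "'a set \<Rightarrow> ('a \<Rightarrow> 'a) \<Rightarrow> ('a \<Rightarrow> real) \<Rightarrow> ('a \<times> real \<Rightarrow> real) \<Rightarrow> real \<Rightarrow> ('a \<times> real) set" where
  "level_set X T \<tau> \<Phi> \<alpha> = {p \<in> susp_dom X \<tau>. ((\<lambda>t. birk_avg T \<tau> \<Phi> p t) \<longlongrightarrow> \<alpha>) at_top}"

text \<open>Borel probability measures on X_tau, represented on the fundamental domain.\<close>
definition susp_prob :: "'a::metric_space set \<Rightarrow> ('a \<Rightarrow> real) \<Rightarrow> ('a \<times> real) measure set" where
  "susp_prob X \<tau> = {\<nu>. sets \<nu> = sets (restrict_space borel (susp_dom X \<tau>)) \<and> prob_space \<nu>}"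

definition inv_measures :: "'a::metric_space set \<Rightarrow> ('a \<Rightarrow> 'a) \<Rightarrow> ('a \<Rightarrow> real) \<Rightarrow> ('a \<times> real) measure set" where
  "inv_measures X T \<tau> = {\<nu> \<in> susp_prob X \<tau>.
      \<forall>t\<ge>0. \<forall>A\<in>sets \<nu>. emeasure \<nu> (susp_flow T \<tau> t -` A \<inter> space \<nu>) = emeasure \<nu> A}"

text \<open>V(p): weak* limit points of the empirical measures delta_{p,t} as t \<rightarrow> \<infinity>
  (sequential, as the space of probability measures on X_tau is metrizable).\<close>
definition limit_measures :: "'a::metric_space set \<Rightarrow> ('a \<Rightarrow> 'a) \<Rightarrow> ('a \<Rightarrow> real) \<Rightarrow> 'a \<times> real \<Rightarrow> ('a \<times> real) measure set" where
  "limit_measures X T \<tau> p = {\<nu> \<in> susp_prob X \<tau>.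
      \<exists>tn :: nat \<Rightarrow> real. filterlim tn at_top sequentially \<and>
        (\<forall>f. susp_cont X T \<tau> f \<longrightarrow> (\<lambda>n. birk_avg T \<tau> f p (tn n)) \<longlonglongrightarrow> integral\<^sup>L \<nu> f)}"

end

theory Submission
  imports Defs
begin

text \<open>
  Limit points of empirical measures are invariant, so the nontrivial inequality is to realise the
  integrals of \<open>\<Phi>\<close> and \<open>H\<close> against an arbitrary, possibly non-ergodic, invariant measure \<open>\<nu>\<close> by Birkhoff
  averages along a single orbit. No ergodic theory is needed. Let \<open>g\<close> be the \<open>\<real>\<^sup>2\<close>-valued function on \<open>X\<close>
  whose components are the integrals of \<open>\<Phi> - \<integral>\<Phi> d\<nu>\<close> and \<open>H - \<integral>H d\<nu>\<close> over the fibres of the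
  suspension. Invariance shows that the measure on \<open>X\<close> induced by \<open>\<nu>\<close> annihilates all the Birkhoff sums
  \<open>S\<^sub>n g\<close>, so for every vector \<open>w\<close> there is an \<open>x\<close> with \<open>w \<bullet> S\<^sub>n g x \<le> 0\<close>. Choosing orbit segments greedily,
  with \<open>w\<close> the sum over the segments already chosen, keeps the squared norm of the total sum linear in the
  number of segments (as in Blackwell's approachability theorem); the specification property
  then yields a point of \<open>X\<close> shadowing all these segments, whose Birkhoff sums are \<open>o(n)\<close>.
\<close>

section \<open>Orbits with sublinear Birkhoff sums\<close>

text \<open>Two obstacles shape the argument. The gap in the specification property depends on the
  accuracy, and only finitely many segments are glued at once; at a fixed accuracy \<delta> the sums
  are therefore controlled only up to \<delta> per step and over a finite horizon. So the accuracy
  improves along the orbit: each stage treats the orbit built so far as one segment to be shadowed,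
  halves \<delta>, and starts so late that the additive constants of the stages are negligible
  against the elapsed time. The stages converge to a single point. It must serve \<Phi> and
  \<open>H\<close> at once, hence the vector-valued \<open>g\<close>. On the measure side, points
  are represented in the fundamental domain, which is not compact and on which the flow jumps at the
  roof. Weak limits are therefore taken on the compact closed domain, where the roof may receive
  mass, and are moved back by \<open>\<theta> 0\<close>, a change that functions compatible with the
  identification do not notice.\<close>

lemma sum_lessThan_add:
  fixes f :: "nat \<Rightarrow> 'v::comm_monoid_add"
  shows "(\<Sum>i<a + b. f i) = (\<Sum>i<a. f i) + (\<Sum>i<b. f (a + i))"
  by (induction b) (auto simp: add.assoc)

lemma funpow_in_set:
  assumes "T ` X \<subseteq> X" "x \<in> X"
  shows "(T ^^ n) x \<in> X"
  using assms by (induction n) auto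

lemma continuous_on_funpow:
  assumes "continuous_on X T" "T ` X \<subseteq> X"
  shows "continuous_on X (T ^^ n)"
proof (induction n)
  case (Suc n)
  have "continuous_on ((T ^^ n) ` X) T"
    using assms funpow_in_set[OF assms(2)] by (meson continuous_on_subset image_subsetI)
  with Suc show ?case by (auto simp: o_def dest: continuous_on_compose)
qed (auto simp: id_def)

text \<open>Gaps and shadowing errors each cost a fixed fraction of \<delta> per step, while the
  greedy block sums grow only like the square root of the number of blocks. The order of quantifiers
  matters: \<open>C\<close> does not depend on \<open>z\<close>, \<open>M\<close> or
  \<open>R\<close>, because the switching times \<open>M\<close> are later chosen in terms of these
  constants. The horizon \<open>R\<close> is finite since specification glues finitely many
  segments.\<close>

lemma shadowing_with_small_sums:
  fixes g :: "'a::metric_space \<Rightarrow> 'v::real_inner"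
  assumes X: "compact X" and TX: "T ` X \<subseteq> X" and spec: "has_specification X T"
    and g: "continuous_on X g"
    and dir: "\<And>w n. \<exists>x\<in>X. w \<bullet> (\<Sum>i<n. g ((T ^^ i) x)) \<le> 0"
    and \<delta>: "0 < \<delta>"
  shows "\<exists>C\<ge>0. \<forall>z\<in>X. \<forall>M\<ge>1. \<forall>R. \<exists>z'\<in>X. (\<forall>i<M. dist ((T ^^ i) z') ((T ^^ i) z) < \<delta>) \<and>
           (\<forall>k\<le>R. norm (\<Sum>i<k. g ((T ^^ (M + i)) z')) \<le> C + \<delta> * real k)"
proof -
  have inX: "(T ^^ i) x \<in> X" if "x \<in> X" for x i
    using funpow_in_set[OF TX that] .
  have "bounded (g ` X)"
    using X g by (simp add: compact_continuous_image compact_imp_bounded)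
  then obtain G where G: "0 < G" "\<And>x. x \<in> X \<Longrightarrow> norm (g x) \<le> G"
    by (auto simp: bounded_pos)
  have "uniformly_continuous_on X g"
    using X g by (rule compact_uniformly_continuous[rotated])
  then obtain \<epsilon>' where \<epsilon>': "0 < \<epsilon>'"
    "\<And>x y. x \<in> X \<Longrightarrow> y \<in> X \<Longrightarrow> dist y x < \<epsilon>' \<Longrightarrow> dist (g y) (g x) < \<delta> / 4"
    using \<delta> unfolding uniformly_continuous_on_def by (metis zero_less_divide_iff zero_less_numeral)
  define \<epsilon> where "\<epsilon> = min \<epsilon>' \<delta>"
  have \<epsilon>: "0 < \<epsilon>" using \<epsilon>' \<delta> by (simp add: \<epsilon>_def)
  obtain m where m: "\<forall>(k::nat) (a::nat \<Rightarrow> nat) (b::nat \<Rightarrow> nat) (xs::nat \<Rightarrow> 'a).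
        (\<forall>j<k. a j \<le> b j \<and> xs j \<in> X) \<and> (\<forall>j. Suc j < k \<longrightarrow> b j + m \<le> a (Suc j)) \<longrightarrow>
        (\<exists>x\<in>X. \<forall>j<k. \<forall>p\<le>b j - a j. dist ((T ^^ (p + a j)) x) ((T ^^ p) (xs j)) < \<epsilon>)"
    using spec[unfolded has_specification_def, rule_format, OF \<epsilon>] by (elim exE)
  \<comment> \<open>The \<open>m\<close> uncontrolled terms in a gap sum to at most
    \<open>m * G\<close>; for a block this long that is at most a quarter of
    \<open>\<delta> * n\<close>.\<close>
  obtain n' :: nat where n': "4 * (real m * G) / \<delta> < real n'"
    using reals_Archimedean2 by blast
  define n where "n = Suc n'"
  have n: "4 * (real m * G) / \<delta> < real n" and n0: "0 < n"
    using n' by (auto simp: n_def)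
  have nm: "real m * G \<le> \<delta> / 4 * real n"
    using n \<delta> by (simp add: field_simps)
  define Sn where "Sn = (\<lambda>x. \<Sum>i<n. g ((T ^^ i) x))"
  have "\<exists>c. \<forall>w. c w \<in> X \<and> w \<bullet> Sn (c w) \<le> 0"
    unfolding Sn_def by (intro choice) (use dir in blast)
  then obtain c where c: "\<And>w. c w \<in> X" "\<And>w. w \<bullet> Sn (c w) \<le> 0" by blast
  \<comment> \<open>\<open>W q\<close> adds block sums along the model points \<open>c w\<close>,
    not along the shadowing point, so the whole sequence of segments is fixed before specification
    is applied.\<close>
  define W where "W = (\<lambda>q. ((\<lambda>w. w + Sn (c w)) ^^ q) 0)"
  have W_Suc: "W (Suc q) = W q + Sn (c (W q))" and W_0: "W 0 = 0" for q
    by (auto simp: W_def)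
  have Sn_le: "norm (Sn x) \<le> real n * G" if "x \<in> X" for x
    unfolding Sn_def using sum_norm_bound[of "{..<n}" "\<lambda>i. g ((T ^^ i) x)" G] G inX[OF that] by auto
  have W_sq: "(norm (W q))\<^sup>2 \<le> real q * (real n * G)\<^sup>2" for q
  proof (induction q)
    case (Suc q)
    have "(norm (W (Suc q)))\<^sup>2 = (norm (W q))\<^sup>2 + 2 * (W q \<bullet> Sn (c (W q))) + (norm (Sn (c (W q))))\<^sup>2"
      unfolding W_Suc power2_norm_eq_inner by (simp add: inner_add inner_commute)
    also have "\<dots> \<le> real q * (real n * G)\<^sup>2 + 0 + (real n * G)\<^sup>2"
      using Suc c(2)[of "W q"] Sn_le[OF c(1)] by (intro add_mono power_mono) auto
    finally show ?case by (simp add: algebra_simps)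
  qed (simp add: W_0)
  \<comment> \<open>Arithmetic-geometric mean: the product of the two summands is chosen so that
    four times it is the bound in \<open>W_sq\<close>. Growth like the square root of
    \<open>q\<close> becomes a small slope plus a constant.\<close>
  have W_le: "norm (W q) \<le> \<delta> / 4 * (real q * real n) + real n * G\<^sup>2 / \<delta>" for q
  proof (rule power2_le_imp_le)
    let ?a = "\<delta> / 4 * (real q * real n)" and ?b = "real n * G\<^sup>2 / \<delta>"
    have "real q * (real n * G)\<^sup>2 = 4 * ?a * ?b"
      using \<delta> by (simp add: power2_eq_square)
    also have "\<dots> \<le> (?a + ?b)\<^sup>2"
      using zero_le_power2[of "?a - ?b"] by (simp add: power2_eq_square algebra_simps)
    finally show "(norm (W q))\<^sup>2 \<le> (?a + ?b)\<^sup>2" using W_sq[of q] by linarith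
    show "0 \<le> ?a + ?b" using \<delta> by simp
  qed
  define l where "l = n + m"
  have l0: "0 < l" using n0 by (simp add: l_def)
  \<comment> \<open>The first summand is the constant in \<open>W_le\<close>; the second pays for
    the incomplete period at the end.\<close>
  define C where "C = real n * G\<^sup>2 / \<delta> + real l * G"
  have "\<exists>z'\<in>X. (\<forall>i<M. dist ((T ^^ i) z') ((T ^^ i) z) < \<delta>) \<and>
           (\<forall>k\<le>R. norm (\<Sum>i<k. g ((T ^^ (M + i)) z')) \<le> C + \<delta> * real k)"
    if z: "z \<in> X" and M: "1 \<le> M" for z and M R :: nat
  proof -
    \<comment> \<open>Segment 0 follows \<open>z\<close> at times 0 to \<open>M - 1\<close>. After
      it, every period of length \<open>l\<close> consists of a gap of length \<open>m\<close> and
      then a block of length \<open>n\<close>. As \<open>M\<close> is at least 1, no truncation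
      occurs in \<open>M - 1\<close>.\<close>
    define a where "a = (\<lambda>j. if j = 0 then 0 else M + m + (j - 1) * l)"
    define b where "b = (\<lambda>j. if j = 0 then M - 1 else M + m + (j - 1) * l + (n - 1))"
    define xs where "xs = (\<lambda>j. if j = 0 then z else c (W (j - 1)))"
    \<comment> \<open>One initial segment and \<open>R + 1\<close> blocks; periods have length at
      least 1, so these reach beyond time \<open>R\<close>.\<close>
    have "\<exists>x\<in>X. \<forall>j<R + 2. \<forall>p\<le>b j - a j. dist ((T ^^ (p + a j)) x) ((T ^^ p) (xs j)) < \<epsilon>"
    proof (rule m[rule_format], intro conjI)
      show "\<forall>j<R + 2. a j \<le> b j \<and> xs j \<in> X"
        using z c by (auto simp: a_def b_def xs_def)
      have "b j + m \<le> a (Suc j)" for j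
        using n0 M by (cases j) (auto simp: a_def b_def l_def)
      then show "\<forall>j. Suc j < R + 2 \<longrightarrow> b j + m \<le> a (Suc j)" by blast
    qed
    then obtain z' where z': "z' \<in> X"
      "\<And>j p. j < R + 2 \<Longrightarrow> p \<le> b j - a j \<Longrightarrow> dist ((T ^^ (p + a j)) z') ((T ^^ p) (xs j)) < \<epsilon>"
      by blast
    have first: "dist ((T ^^ i) z') ((T ^^ i) z) < \<delta>" if "i < M" for i
      using z'(2)[of 0 i] that by (auto simp: a_def b_def xs_def \<epsilon>_def)
    define f where "f = (\<lambda>i. g ((T ^^ (M + i)) z'))"
    have f_le: "norm (f i) \<le> G" for i
      unfolding f_def using G inX z'(1) by blast
    have close: "norm (f (q * l + (m + p)) - g ((T ^^ p) (c (W q)))) \<le> \<delta> / 4" if "q \<le> R" "p < n" for q p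
    proof -
      have "dist ((T ^^ (p + a (Suc q))) z') ((T ^^ p) (xs (Suc q))) < \<epsilon>"
        using that by (intro z'(2)) (auto simp: a_def b_def)
      moreover have "p + a (Suc q) = M + (q * l + (m + p))" "xs (Suc q) = c (W q)"
        by (auto simp: a_def xs_def)
      ultimately have "dist ((T ^^ (M + (q * l + (m + p)))) z') ((T ^^ p) (c (W q))) < \<epsilon>'"
        by (simp add: \<epsilon>_def)
      then show ?thesis
        unfolding f_def using \<epsilon>'(2) inX[OF z'(1)] inX[OF c(1)] by (metis dist_norm less_imp_le)
    qed
    have block: "norm ((\<Sum>i<l. f (q * l + i)) - Sn (c (W q))) \<le> \<delta> / 2 * real n" if "q \<le> R" for q
    proof -
      have "(\<Sum>i<l. f (q * l + i)) = (\<Sum>i<m. f (q * l + i)) + (\<Sum>p<n. f (q * l + (m + p)))"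
        using sum_lessThan_add[of "\<lambda>i. f (q * l + i)" m n] by (simp add: l_def add.commute[of n m])
      then have "norm ((\<Sum>i<l. f (q * l + i)) - Sn (c (W q))) =
          norm ((\<Sum>i<m. f (q * l + i)) + (\<Sum>p<n. f (q * l + (m + p)) - g ((T ^^ p) (c (W q)))))"
        by (simp add: Sn_def sum_subtractf add_diff_eq)
      also have "\<dots> \<le> real m * G + real n * (\<delta> / 4)"
      proof (rule norm_triangle_mono)
        show "norm (\<Sum>i<m. f (q * l + i)) \<le> real m * G"
          using sum_norm_bound[of "{..<m}" "\<lambda>i. f (q * l + i)" G] f_le by simp
        show "norm (\<Sum>p<n. f (q * l + (m + p)) - g ((T ^^ p) (c (W q)))) \<le> real n * (\<delta> / 4)"
          using sum_norm_bound[of "{..<n}" "\<lambda>p. f (q * l + (m + p)) - g ((T ^^ p) (c (W q)))" "\<delta> / 4"]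
            close[OF that] by simp
      qed
      also have "\<dots> \<le> \<delta> / 2 * real n" using nm by simp
      finally show ?thesis .
    qed
    have blocks: "norm ((\<Sum>i<q * l. f i) - W q) \<le> \<delta> / 2 * (real q * real n)" if "q \<le> Suc R" for q
      using that
    proof (induction q)
      case (Suc q)
      have "(\<Sum>i<Suc q * l. f i) = (\<Sum>i<q * l. f i) + (\<Sum>i<l. f (q * l + i))"
        using sum_lessThan_add[of f "q * l" l] by (simp add: add.commute)
      then have "norm ((\<Sum>i<Suc q * l. f i) - W (Suc q)) =
          norm (((\<Sum>i<q * l. f i) - W q) + ((\<Sum>i<l. f (q * l + i)) - Sn (c (W q))))"
        by (simp add: W_Suc algebra_simps)
      also have "\<dots> \<le> \<delta> / 2 * (real q * real n) + \<delta> / 2 * real n"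
        using Suc block[of q] by (intro norm_triangle_mono) auto
      finally show ?case by (simp add: algebra_simps)
    qed (simp add: W_0)
    have "norm (\<Sum>i<k. f i) \<le> C + \<delta> * real k" if "k \<le> R" for k
    proof -
      define q where "q = k div l"
      have k: "k = q * l + k mod l" and "k mod l \<le> l" and q: "q \<le> Suc R"
        using l0 that div_le_dividend[of k l] mod_less_divisor[of l k] by (auto simp: q_def simp del: div_le_dividend mod_less_divisor)
      have "(\<Sum>i<k. f i) = (\<Sum>i<q * l. f i) + (\<Sum>i<k mod l. f (q * l + i))"
        using sum_lessThan_add[of f "q * l" "k mod l"] k by simp
      also have "\<dots> = ((\<Sum>i<q * l. f i) - W q) + W q + (\<Sum>i<k mod l. f (q * l + i))" by simp
      also have "norm \<dots> \<le> \<delta> / 2 * (real q * real n) + (\<delta> / 4 * (real q * real n) + real n * G\<^sup>2 / \<delta>) + real l * G"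
      proof (intro norm_triangle_mono blocks[OF q] W_le)
        have "norm (\<Sum>i<k mod l. f (q * l + i)) \<le> real (k mod l) * G"
          using sum_norm_bound[of "{..<k mod l}" "\<lambda>i. f (q * l + i)" G] f_le by simp
        also have "\<dots> \<le> real l * G"
          using \<open>k mod l \<le> l\<close> G by (intro mult_right_mono) auto
        finally show "norm (\<Sum>i<k mod l. f (q * l + i)) \<le> real l * G" .
      qed
      \<comment> \<open>Half of \<delta> comes from gaps and shadowing, a quarter from
        \<open>W_le\<close>; the total slope 3/4 is charged to block steps only, of which there are
        at most \<open>k\<close>.\<close>
      also have "\<dots> = C + \<delta> * (3 / 4 * (real q * real n))"
        by (simp add: C_def algebra_simps)
      also have "\<dots> \<le> C + \<delta> * real k"
      proof -
        have "q * n \<le> k" using k by (metis add_leD1 l_def le_add1 mult_le_mono2 order_trans)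
        then have "3 / 4 * (real q * real n) \<le> real k"
          using of_nat_mono[of "q * n" k, where 'a = real] by simp
        then show ?thesis using \<delta> by simp
      qed
      finally show ?thesis .
    qed
    then show ?thesis using z'(1) first unfolding f_def by blast
  qed
  moreover have "0 \<le> C" using \<delta> G by (simp add: C_def)
  ultimately show ?thesis by blast
qed

text \<open>Fixes the starting times of the stages: when stage \<open>s\<close> begins, the elapsed
  time already exceeds by a factor \<open>s\<close> all constants incurred so far, including that of
  stage \<open>s\<close> itself.\<close>

lemma strict_mono_dominating_partial_sums:
  fixes C :: "nat \<Rightarrow> real"
  assumes "\<And>s. 0 \<le> C s"
  obtains M :: "nat \<Rightarrow> nat" where "strict_mono M" "\<And>s. 1 \<le> M s" "\<And>s. real s * (\<Sum>l\<le>s. C l) \<le> real (M s)"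
proof
  define K where "K = (\<lambda>s. nat \<lceil>real s * (\<Sum>l\<le>s. C l)\<rceil>)"
  define M where "M = (\<lambda>s. 1 + s + (\<Sum>l\<le>s. K l))"
  show "strict_mono M" by (rule strict_monoI_Suc) (simp add: M_def)
  show "1 \<le> M s" for s by (simp add: M_def)
  show "real s * (\<Sum>l\<le>s. C l) \<le> real (M s)" for s
  proof -
    have "real s * (\<Sum>l\<le>s. C l) \<le> real (K s)" by (simp add: K_def real_nat_ceiling_ge)
    also have "K s \<le> (\<Sum>l\<le>s. K l)" by (rule member_le_sum) auto
    then have "K s \<le> M s" by (simp add: M_def)
    finally show ?thesis by simp
  qed
qed

text \<open>Stage \<open>s\<close> changes the orbit before time \<open>M s\<close> by less than
  \<open>\<delta> s\<close> and controls the sums between \<open>M s\<close> and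
  \<open>M (Suc s)\<close> with slope \<open>\<delta> s\<close>. The changes are summable, so the
  approximants converge, and by uniform continuity of \<open>g\<close> the limit point inherits the
  control of every stage.\<close>

theorem specification_sublinear_sums:
  fixes g :: "'a::metric_space \<Rightarrow> 'v::real_inner"
  assumes X: "compact X" "X \<noteq> {}" and T: "continuous_on X T" and TX: "T ` X \<subseteq> X"
    and spec: "has_specification X T" and g: "continuous_on X g"
    and dir: "\<And>w n. \<exists>x\<in>X. w \<bullet> (\<Sum>i<n. g ((T ^^ i) x)) \<le> 0"
  obtains z where "z \<in> X" "\<And>\<epsilon>. 0 < \<epsilon> \<Longrightarrow> \<exists>K. \<forall>n. norm (\<Sum>i<n. g ((T ^^ i) z)) \<le> K + \<epsilon> * real n"
proof -
  have inX: "(T ^^ i) x \<in> X" if "x \<in> X" for x i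
    using funpow_in_set[OF TX that] .
  define \<delta> :: "nat \<Rightarrow> real" where "\<delta> s = (1 / 2) ^ s" for s
  have \<delta>_pos: "0 < \<delta> s" for s by (simp add: \<delta>_def)
  have "\<exists>C. \<forall>s. 0 \<le> C s \<and> (\<forall>z\<in>X. \<forall>M\<ge>1. \<forall>R. \<exists>z'\<in>X. (\<forall>i<M. dist ((T ^^ i) z') ((T ^^ i) z) < \<delta> s) \<and>
           (\<forall>k\<le>R. norm (\<Sum>i<k. g ((T ^^ (M + i)) z')) \<le> C s + \<delta> s * real k))"
    by (intro choice allI, rule shadowing_with_small_sums[OF X(1) TX spec g dir \<delta>_pos])
  then obtain C where C: "\<And>s. 0 \<le> C s" and ext: "\<And>s z M R. z \<in> X \<Longrightarrow> 1 \<le> M \<Longrightarrow>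
      \<exists>z'\<in>X. (\<forall>i<M. dist ((T ^^ i) z') ((T ^^ i) z) < \<delta> s) \<and>
           (\<forall>k\<le>R. norm (\<Sum>i<k. g ((T ^^ (M + i)) z')) \<le> C s + \<delta> s * real k)"
    by metis
  obtain M where M: "strict_mono M" "\<And>s. 1 \<le> M s" "\<And>s. real s * (\<Sum>l\<le>s. C l) \<le> real (M s)"
    using strict_mono_dominating_partial_sums C by metis
  have M_mono: "M s \<le> M t" if "s \<le> t" for s t
    using M(1) that by (simp add: strict_mono_less_eq)
  obtain z0 where "z0 \<in> X" using X by auto
  have "\<exists>z. \<forall>s. z s \<in> X \<and> (\<forall>i<M s. dist ((T ^^ i) (z (Suc s))) ((T ^^ i) (z s)) < \<delta> s) \<and>
      (\<forall>k\<le>M (Suc s) - M s. norm (\<Sum>i<k. g ((T ^^ (M s + i)) (z (Suc s)))) \<le> C s + \<delta> s * real k)"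
    by (rule dependent_nat_choice[of "\<lambda>_ x. x \<in> X" "\<lambda>s x y. (\<forall>i<M s. dist ((T ^^ i) y) ((T ^^ i) x) < \<delta> s) \<and>
      (\<forall>k\<le>M (Suc s) - M s. norm (\<Sum>i<k. g ((T ^^ (M s + i)) y)) \<le> C s + \<delta> s * real k)", simplified])
      (use \<open>z0 \<in> X\<close> ext M(2) in blast)+
  then obtain z where z: "\<And>s. z s \<in> X"
    and z_step: "\<And>s i. i < M s \<Longrightarrow> dist ((T ^^ i) (z (Suc s))) ((T ^^ i) (z s)) < \<delta> s"
    and z_sum: "\<And>s k. k \<le> M (Suc s) - M s \<Longrightarrow>
      norm (\<Sum>i<k. g ((T ^^ (M s + i)) (z (Suc s)))) \<le> C s + \<delta> s * real k"
    by metis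
  \<comment> \<open>Subtracting the tail of the geometric series makes the estimate inductive in
    \<open>k\<close>.\<close>
  have z_dist: "dist ((T ^^ i) (z (s + k))) ((T ^^ i) (z s)) \<le> 2 * \<delta> s - 2 * \<delta> (s + k)" if "i < M s" for i s k
  proof (induction k)
    case (Suc k)
    have "i < M (s + k)" using that M_mono[of s "s + k"] by simp
    then have "dist ((T ^^ i) (z (s + Suc k))) ((T ^^ i) (z s)) \<le> \<delta> (s + k) + (2 * \<delta> s - 2 * \<delta> (s + k))"
      using z_step[of i "s + k"] Suc dist_triangle[of "(T ^^ i) (z (s + Suc k))" "(T ^^ i) (z s)" "(T ^^ i) (z (s + k))"]
      by simp
    also have "\<dots> = 2 * \<delta> s - 2 * \<delta> (s + Suc k)" by (simp add: \<delta>_def)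
    finally show ?case .
  qed simp
  have z_dist': "dist ((T ^^ i) (z t)) ((T ^^ i) (z s)) \<le> 2 * \<delta> s" if "i < M s" "s \<le> t" for i s t
    using z_dist[OF that(1), of "t - s"] that(2) \<delta>_pos[of t] by simp
  have \<delta>_lim: "\<delta> \<longlonglongrightarrow> 0" unfolding \<delta>_def by (rule LIMSEQ_realpow_zero) auto
  have "Cauchy z"
  proof (rule metric_CauchyI)
    fix e :: real assume "0 < e"
    then have "\<forall>\<^sub>F s in sequentially. \<delta> s < e / 4"
      using \<delta>_lim by (intro order_tendstoD) auto
    then obtain N where N: "\<delta> N < e / 4" by (auto simp: eventually_sequentially)
    have *: "dist (z t) (z N) \<le> e / 2" if "N \<le> t" for t
      using z_dist'[of 0 N t] that M(2)[of N] N by simp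
    show "\<exists>N. \<forall>m\<ge>N. \<forall>n\<ge>N. dist (z m) (z n) < e"
    proof (intro exI allI impI)
      fix m n assume "N \<le> m" "N \<le> n"
      then show "dist (z m) (z n) < e"
        using z_dist'[of 0 N m] z_dist'[of 0 N n] M(2)[of N] N dist_triangle2[of "z m" "z n" "z N"] by simp
    qed
  qed
  then obtain x where x: "x \<in> X" "z \<longlonglongrightarrow> x"
    using compact_imp_complete[OF X(1)] z unfolding complete_def by blast
  have x_dist: "dist ((T ^^ i) x) ((T ^^ i) (z s)) \<le> 2 * \<delta> s" if "i < M s" for i s
  proof (rule LIMSEQ_le_const2)
    have "(\<lambda>t. (T ^^ i) (z t)) \<longlonglongrightarrow> (T ^^ i) x"
      using continuous_on_tendsto_compose[OF continuous_on_funpow[OF T TX] x(2,1)] z by simp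
    then show "(\<lambda>t. dist ((T ^^ i) (z t)) ((T ^^ i) (z s))) \<longlonglongrightarrow> dist ((T ^^ i) x) ((T ^^ i) (z s))"
      by (intro tendsto_intros)
    show "\<exists>N. \<forall>t\<ge>N. dist ((T ^^ i) (z t)) ((T ^^ i) (z s)) \<le> 2 * \<delta> s"
      using z_dist'[OF that] by blast
  qed
  have "bounded (g ` X)"
    using X g by (simp add: compact_continuous_image compact_imp_bounded)
  then obtain G where G: "0 < G" "\<And>y. y \<in> X \<Longrightarrow> norm (g y) \<le> G"
    by (auto simp: bounded_pos)
  have "\<exists>K. \<forall>n. norm (\<Sum>i<n. g ((T ^^ i) x)) \<le> K + \<epsilon> * real n" if "0 < \<epsilon>" for \<epsilon>
  proof -
    have "uniformly_continuous_on X g"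
      using X g by (intro compact_uniformly_continuous)
    then obtain \<eta> where \<eta>: "0 < \<eta>"
      "\<And>x y. x \<in> X \<Longrightarrow> y \<in> X \<Longrightarrow> dist y x < \<eta> \<Longrightarrow> dist (g y) (g x) < \<epsilon> / 4"
      using \<open>0 < \<epsilon>\<close> unfolding uniformly_continuous_on_def by (metis zero_less_divide_iff zero_less_numeral)
    have "\<forall>\<^sub>F s in sequentially. \<delta> s < min \<eta> (\<epsilon> / 4)"
      using \<delta>_lim \<eta> \<open>0 < \<epsilon>\<close> by (intro order_tendstoD) auto
    then obtain s1 where s1: "\<And>s. s1 \<le> s \<Longrightarrow> \<delta> s < min \<eta> (\<epsilon> / 4)" by (auto simp: eventually_sequentially)
    \<comment> \<open>From stage \<open>s2\<close> on, the choice of \<open>M\<close> bounds the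
      accumulated constants by \<open>\<epsilon> / 2\<close> times the elapsed time.\<close>
    obtain s2 :: nat where s2: "2 / \<epsilon> < real s2" using reals_Archimedean2 by blast
    define s0 where "s0 = max s1 s2"
    have stage: "norm (\<Sum>i<k. g ((T ^^ (M s + i)) x)) \<le> C s + \<epsilon> / 2 * real k"
      if "s0 \<le> s" "k \<le> M (Suc s) - M s" for s k
    proof -
      have "norm (g ((T ^^ (M s + i)) x) - g ((T ^^ (M s + i)) (z (Suc s)))) \<le> \<epsilon> / 4" if "i < k" for i
      proof -
        have "M s + i < M (Suc s)" using that \<open>k \<le> M (Suc s) - M s\<close> by simp
        \<comment> \<open>The factor 2 in \<open>x_dist\<close> at stage \<open>Suc s\<close> is
          cancelled by the halving of \<delta>.\<close>
        then have "dist ((T ^^ (M s + i)) x) ((T ^^ (M s + i)) (z (Suc s))) \<le> \<delta> s"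
          using x_dist[of "M s + i" "Suc s"] by (simp add: \<delta>_def)
        also have "\<dots> < \<eta>" using s1[of s] \<open>s0 \<le> s\<close> by (simp add: s0_def)
        finally show ?thesis
          using \<eta>(2) inX x(1) z by (metis dist_norm less_imp_le)
      qed
      then have "norm (\<Sum>i<k. g ((T ^^ (M s + i)) x) - g ((T ^^ (M s + i)) (z (Suc s)))) \<le> real k * (\<epsilon> / 4)"
        using sum_norm_bound[of "{..<k}" "\<lambda>i. g ((T ^^ (M s + i)) x) - g ((T ^^ (M s + i)) (z (Suc s)))" "\<epsilon> / 4"] by simp
      moreover have "(\<Sum>i<k. g ((T ^^ (M s + i)) x)) = (\<Sum>i<k. g ((T ^^ (M s + i)) (z (Suc s)))) +
          (\<Sum>i<k. g ((T ^^ (M s + i)) x) - g ((T ^^ (M s + i)) (z (Suc s))))"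
        by (simp add: sum_subtractf)
      moreover have "\<delta> s * real k \<le> \<epsilon> / 4 * real k"
        using s1[of s] \<open>s0 \<le> s\<close> by (intro mult_right_mono) (auto simp: s0_def)
      ultimately have "norm (\<Sum>i<k. g ((T ^^ (M s + i)) x)) \<le> (C s + \<epsilon> / 4 * real k) + real k * (\<epsilon> / 4)"
        using z_sum[OF that(2)] by (simp only:) (intro norm_triangle_mono, auto)
      then show ?thesis by simp
    qed
    have stages: "norm (\<Sum>i<M s. g ((T ^^ i) x)) \<le> G * real (M s0) + (\<Sum>l\<in>{s0..<s}. C l) + \<epsilon> / 2 * real (M s)"
      if "s0 \<le> s" for s
      using that
    proof (induction s rule: dec_induct)
      case base
      have "norm (\<Sum>i<M s0. g ((T ^^ i) x)) \<le> real (M s0) * G"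
        using sum_norm_bound[of "{..<M s0}" "\<lambda>i. g ((T ^^ i) x)" G] G inX[OF x(1)] by simp
      then show ?case using \<open>0 < \<epsilon>\<close> by (simp add: mult.commute add_increasing2)
    next
      case (step s)
      define k where "k = M (Suc s) - M s"
      have k: "M (Suc s) = M s + k" using M_mono[of s "Suc s"] by (simp add: k_def)
      have "norm (\<Sum>i<M (Suc s). g ((T ^^ i) x)) \<le>
          (G * real (M s0) + (\<Sum>l\<in>{s0..<s}. C l) + \<epsilon> / 2 * real (M s)) + (C s + \<epsilon> / 2 * real k)"
        unfolding k sum_lessThan_add using step stage[of s k] by (intro norm_triangle_mono) (auto simp: k_def)
      then show ?case using step.hyps by (simp add: k algebra_simps)
    qed
    have "norm (\<Sum>i<n. g ((T ^^ i) x)) \<le> G * real (M s0) + \<epsilon> * real n" for n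
    proof (cases "n \<le> M s0")
      case True
      have "norm (\<Sum>i<n. g ((T ^^ i) x)) \<le> real n * G"
        using sum_norm_bound[of "{..<n}" "\<lambda>i. g ((T ^^ i) x)" G] G inX[OF x(1)] by simp
      also have "\<dots> \<le> real (M s0) * G" using True G by (intro mult_right_mono) auto
      finally show ?thesis using \<open>0 < \<epsilon>\<close> by (simp add: mult.commute add_increasing2)
    next
      case False
      \<comment> \<open>The stage to which time \<open>n\<close> belongs. The greatest element
        exists because \<open>s\<close> is at most \<open>M s\<close>, so only finitely many stages
        start by time \<open>n\<close>.\<close>
      define s where "s = (GREATEST s. M s \<le> n)"
      have bound: "\<And>s. M s \<le> n \<Longrightarrow> s \<le> n" using M(1) strict_mono_imp_increasing order_trans by metis
      have Ms: "M s \<le> n"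
        unfolding s_def using False bound by (intro GreatestI_nat[of "\<lambda>s. M s \<le> n" s0 n]) auto
      have le_s: "t \<le> s" if "M t \<le> n" for t
        unfolding s_def using that bound by (rule Greatest_le_nat[of "\<lambda>s. M s \<le> n"])
      have "s0 \<le> s" using le_s False by simp
      have "n < M (Suc s)"
        using le_s[of "Suc s"] by (cases "n < M (Suc s)") auto
      define k where "k = n - M s"
      have n: "n = M s + k" using Ms by (simp add: k_def)
      have "norm (\<Sum>i<n. g ((T ^^ i) x)) \<le>
          (G * real (M s0) + (\<Sum>l\<in>{s0..<s}. C l) + \<epsilon> / 2 * real (M s)) + (C s + \<epsilon> / 2 * real k)"
        unfolding n sum_lessThan_add using stages[OF \<open>s0 \<le> s\<close>] stage[OF \<open>s0 \<le> s\<close>, of k] \<open>n < M (Suc s)\<close> Ms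
        by (intro norm_triangle_mono) (auto simp: k_def)
      also have "\<dots> = G * real (M s0) + (\<Sum>l\<in>{s0..s}. C l) + \<epsilon> / 2 * real n"
        using \<open>s0 \<le> s\<close> by (simp add: n algebra_simps flip: atLeastLessThanSuc_atLeastAtMost)
      also have "(\<Sum>l\<in>{s0..s}. C l) \<le> (\<Sum>l\<le>s. C l)" using C by (intro sum_mono2) auto
      also have "\<dots> \<le> \<epsilon> / 2 * real n"
      proof -
        have "2 / \<epsilon> * (\<Sum>l\<le>s. C l) \<le> real s * (\<Sum>l\<le>s. C l)"
          using s2 \<open>s0 \<le> s\<close> C by (intro mult_right_mono sum_nonneg) (auto simp: s0_def)
        also have "\<dots> \<le> real n" using M(3)[of s] Ms by linarith
        finally show ?thesis using \<open>0 < \<epsilon>\<close> by (simp add: field_simps)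
      qed
      finally show ?thesis by simp
    qed
    then show ?thesis by blast
  qed
  then show thesis using that x(1) by blast
qed

section \<open>Weak limits on compact sets\<close>

text \<open>Tychonoff in place of a diagonal argument: a product of compact intervals is compact,
  and for a countable index type compactness gives sequential compactness.\<close>

lemma subseq_converging_pointwise:
  fixes a :: "nat \<Rightarrow> 'i::countable \<Rightarrow> real"
  assumes "\<And>n i. a n i \<in> {l..u}"
  obtains r L where "strict_mono r" "\<And>i. (\<lambda>n. a (r n) i) \<longlonglongrightarrow> L i"
proof -
  have "compactin (product_topology (\<lambda>_::'i. euclidean :: real topology) UNIV) (PiE UNIV (\<lambda>_. {l..u}))"
    unfolding compactin_PiE by (simp add: compactin_euclidean_iff)
  then have "seq_compact (PiE UNIV (\<lambda>_::'i. {l..u}))"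
    by (intro compact_imp_seq_compact) (simp add: euclidean_product_topology compactin_euclidean_iff)
  moreover have "a n \<in> PiE UNIV (\<lambda>_. {l..u})" for n using assms by auto
  ultimately obtain L r where Lr: "strict_mono r" "(a \<circ> r) \<longlonglongrightarrow> L"
    unfolding seq_compact_def by meson
  have "(\<lambda>n. (a \<circ> r) n i) \<longlonglongrightarrow> L i" for i
    using continuous_on_tendsto_compose[OF continuous_on_product_coordinates[of i] Lr(2)] by simp
  then show thesis using Lr(1) by (intro that) (simp_all add: o_def)
qed

text \<open>Finitely many membership questions locate a point of \<open>Y\<close> up to any
  prescribed error. The sets are the balls of finite covers of radius \<open>1 / (j + 1)\<close>,
  for all \<open>j\<close> together.\<close>

lemma compact_separating_balls:
  fixes Y :: "'b::metric_space set"
  assumes Y: "compact Y"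
  obtains B :: "nat \<Rightarrow> 'b set" where "\<And>k. open (B k)"
    "\<And>e. 0 < e \<Longrightarrow> \<exists>K. \<forall>y\<in>Y. \<forall>y'\<in>Y. (\<forall>k<K. y \<in> B k \<longleftrightarrow> y' \<in> B k) \<longrightarrow> dist y y' < e"
proof -
  have "\<exists>F. finite F \<and> Y \<subseteq> (\<Union>c\<in>F. ball c (1 / real (Suc j)))" for j
    using compactE_image[OF Y, of Y "\<lambda>c. ball c (1 / real (Suc j))"] by (metis UN_I centre_in_ball
       of_nat_0_less_iff open_ball subsetI zero_less_Suc zero_less_divide_1_iff)
  then obtain F where F: "\<And>j. finite (F j)" "\<And>j. Y \<subseteq> (\<Union>c\<in>F j. ball c (1 / real (Suc j)))"
    by metis
  \<comment> \<open>The empty set is inserted so that \<open>from_nat_into\<close> enumerates a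
    nonempty family even when all the covers are empty.\<close>
  define \<B> where "\<B> = insert {} (\<Union>j. (\<lambda>c. ball c (1 / real (Suc j))) ` F j)"
  have \<B>: "countable \<B>" "\<B> \<noteq> {}"
    unfolding \<B>_def using F(1) by (auto intro: countable_finite)
  define B where "B = from_nat_into \<B>"
  have "open (B k)" for k
  proof -
    have "B k \<in> \<B>" unfolding B_def by (rule from_nat_into[OF \<B>(2)])
    then show ?thesis by (auto simp: \<B>_def)
  qed
  moreover have "\<exists>K. \<forall>y\<in>Y. \<forall>y'\<in>Y. (\<forall>k<K. y \<in> B k \<longleftrightarrow> y' \<in> B k) \<longrightarrow> dist y y' < e" if "0 < e" for e
  proof -
    obtain j where "inverse (real (Suc j)) < e / 2" using reals_Archimedean[of "e / 2"] \<open>0 < e\<close> by auto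
    then have j: "1 / real (Suc j) < e / 2" by (simp add: inverse_eq_divide)
    \<comment> \<open>One more than the largest index of a ball in the \<open>j\<close>-th cover;
      inserting 0 keeps \<open>Max\<close> meaningful for an empty cover.\<close>
    define K where "K = Suc (Max (insert 0 ((\<lambda>c. to_nat_on \<B> (ball c (1 / real (Suc j)))) ` F j)))"
    have "dist y y' < e" if yy: "y \<in> Y" "y' \<in> Y" and same: "\<forall>k<K. y \<in> B k \<longleftrightarrow> y' \<in> B k" for y y'
    proof -
      obtain c where c: "c \<in> F j" "y \<in> ball c (1 / real (Suc j))" using F(2)[of j] yy by blast
      define k where "k = to_nat_on \<B> (ball c (1 / real (Suc j)))"
      have "k < K" unfolding K_def k_def using F(1)[of j] c(1) by (simp add: less_Suc_eq_le)
      moreover have "B k = ball c (1 / real (Suc j))"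
        unfolding B_def k_def using \<B>(1) c(1) by (subst from_nat_into_to_nat_on) (auto simp: \<B>_def)
      ultimately have "y' \<in> ball c (1 / real (Suc j))" using same c(2) by blast
      then show ?thesis using c(2) j dist_triangle_less_add[of y c "e / 2" y' "e / 2"]
        by (simp add: dist_commute)
    qed
    then show ?thesis by blast
  qed
  ultimately show thesis using that by blast
qed

text \<open>Here \<open>h\<close> will be the number of a cell. The approximating measures and their
  weak limit live on different spaces, and both are compared with finite sums over the same cell
  numbers and sample values \<open>g\<close>.\<close>

lemma (in prob_space) integral_approx_by_level_sets:
  fixes f g :: "_ \<Rightarrow> real" and h :: "'a \<Rightarrow> nat"
  assumes f: "integrable M f" and h: "h \<in> M \<rightarrow>\<^sub>M count_space UNIV"
    and le: "\<And>y. y \<in> space M \<Longrightarrow> h y < K \<and> \<bar>f y - g (h y)\<bar> \<le> e"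
  shows "\<bar>integral\<^sup>L M f - (\<Sum>i<K. prob {y \<in> space M. h y = i} * g i)\<bar> \<le> e"
proof -
  let ?A = "\<lambda>i. {y \<in> space M. h y = i}"
  have A: "?A i \<in> sets M" for i
    using measurable_sets[OF h, of "{i}"] by (simp add: vimage_def Int_def conj_commute)
  have int_A: "integrable M (\<lambda>y. indicator (?A i) y * g i)" for i
    using A by (intro integrable_mult_left integrable_real_indicator) (auto simp: emeasure_finite less_top[symmetric])
  have int_g: "integrable M (\<lambda>y. \<Sum>i<K. indicator (?A i) y * g i)"
    by (intro Bochner_Integration.integrable_sum int_A)
  have "(\<Sum>i<K. prob (?A i) * g i) = (\<integral>y. (\<Sum>i<K. indicator (?A i) y * g i) \<partial>M)"
    using A by (subst Bochner_Integration.integral_sum[OF int_A]) (simp add: Int_absorb2 sets.sets_into_space)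
  then have "integral\<^sup>L M f - (\<Sum>i<K. prob (?A i) * g i) = (\<integral>y. f y - (\<Sum>i<K. indicator (?A i) y * g i) \<partial>M)"
    using Bochner_Integration.integral_diff[OF f int_g] by simp
  also have "\<bar>\<dots>\<bar> \<le> (\<integral>y. e \<partial>M)"
  proof (rule integral_abs_bound[THEN order_trans], rule integral_mono)
    show "integrable M (\<lambda>y. \<bar>f y - (\<Sum>i<K. indicator (?A i) y * g i)\<bar>)"
      using f int_g by (intro integrable_abs Bochner_Integration.integrable_diff)
    fix y assume y: "y \<in> space M"
    have "(\<Sum>i<K. indicator (?A i) y * g i) = (\<Sum>i<K. if i = h y then g (h y) else 0)"
      using y by (intro sum.cong) (auto simp: indicator_def)
    also have "\<dots> = g (h y)" using le[OF y] by simp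
    finally show "\<bar>f y - (\<Sum>i<K. indicator (?A i) y * g i)\<bar> \<le> e" using le[OF y] by simp
  qed simp
  finally show ?thesis by (simp add: prob_space)
qed

text \<open>The weak limit is realised as the law of a random point on the unit interval: binary
  Borel partitions of the compact set are coded by nested intervals whose lengths are
  the limiting masses, so that mass accumulating on the boundary of a cell causes no trouble.\<close>

theorem compact_weak_limit:
  fixes Y :: "'b::metric_space set" and N :: "nat \<Rightarrow> 'b measure"
  assumes Y: "compact Y" and sets_N: "\<And>n. sets (N n) = sets (restrict_space borel Y)"
    and prob_N: "\<And>n. prob_space (N n)"
  obtains r \<nu> where "strict_mono r" "sets \<nu> = sets (restrict_space borel Y)" "prob_space \<nu>"
    "\<And>f. continuous_on Y f \<Longrightarrow> (\<lambda>n. integral\<^sup>L (N (r n)) f) \<longlonglongrightarrow> (integral\<^sup>L \<nu> f :: real)"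
proof -
  have space_N: "space (N n) = Y" for n
    using sets_eq_imp_space_eq[OF sets_N] by (simp add: space_restrict_space)
  interpret N: prob_space "N n" for n by (rule prob_N)
  obtain B :: "nat \<Rightarrow> 'b set" where B: "\<And>k. open (B k)"
    "\<And>e. 0 < e \<Longrightarrow> \<exists>K. \<forall>y\<in>Y. \<forall>y'\<in>Y. (\<forall>k<K. y \<in> B k \<longleftrightarrow> y' \<in> B k) \<longrightarrow> dist y y' < e"
    using compact_separating_balls[OF Y] by blast
  \<comment> \<open>Binary code of the answers to the first \<open>k\<close> membership questions,
    the latest in the lowest bit. Halving a code forgets the latest answer, so cells of level
    \<open>Suc k\<close> refine those of level \<open>k\<close>.\<close>
  define q :: "nat \<Rightarrow> 'b \<Rightarrow> nat" where "q = rec_nat (\<lambda>_. 0) (\<lambda>k f y. 2 * f y + of_bool (y \<in> B k))"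
  have q_0: "q 0 y = 0" and q_Suc: "q (Suc k) y = 2 * q k y + of_bool (y \<in> B k)" for k y
    by (auto simp: q_def)
  have q_div: "q (Suc k) y div 2 = q k y" for k y by (simp add: q_Suc)
  have q_less: "q k y < 2 ^ k" for k y
    by (induction k) (auto simp: q_0 q_Suc)
  have q_eq: "\<forall>i<k. y \<in> B i \<longleftrightarrow> y' \<in> B i" if "q k y = q k y'" for k y y'
    using that
  proof (induction k)
    case (Suc k)
    then have "q k y = q k y'" by (metis q_div)
    moreover have "y \<in> B k \<longleftrightarrow> y' \<in> B k"
      using Suc.prems \<open>q k y = q k y'\<close> by (auto simp: q_Suc of_bool_def split: if_splits)
    ultimately show ?case using Suc.IH less_Suc_eq by auto
  qed simp
  have q_meas: "q k \<in> restrict_space borel Y \<rightarrow>\<^sub>M count_space UNIV" for k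
  proof (induction k)
    case (Suc k)
    note Suc[measurable]
    have "B k \<inter> Y \<in> sets (restrict_space borel Y)"
      using B(1) by (auto simp: sets_restrict_space)
    moreover have "{y \<in> space (restrict_space borel Y). y \<in> B k} = B k \<inter> Y" by (auto simp: space_restrict_space)
    ultimately have [measurable]: "Measurable.pred (restrict_space borel Y) (\<lambda>y. y \<in> B k)"
      by (simp add: pred_def)
    show ?case unfolding q_Suc by measurable
  qed (simp add: q_0)
  define cell where "cell k i = {y \<in> Y. q k y = i}" for k i
  have cell_sets: "cell k i \<in> sets (N n)" for k i n
    using measurable_sets[OF q_meas, of "{i}" k] unfolding sets_N
    by (simp add: cell_def vimage_def Int_def space_restrict_space conj_commute)
  define \<mu> where "\<mu> n p = measure (N n) (cell (fst p) (snd p))" for n and p :: "nat \<times> nat"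
  obtain r M where r: "strict_mono r" and lim: "\<And>p. (\<lambda>n. \<mu> (r n) p) \<longlonglongrightarrow> M p"
    using subseq_converging_pointwise[of \<mu> 0 1] by (auto simp: \<mu>_def)
  define m where "m k i = M (k, i)" for k i
  have lim_m: "(\<lambda>n. measure (N (r n)) (cell k i)) \<longlonglongrightarrow> m k i" for k i
    using lim[of "(k, i)"] by (simp add: \<mu>_def m_def)
  have m_nonneg: "0 \<le> m k i" for k i
    by (rule LIMSEQ_le_const[OF lim_m]) auto
  \<comment> \<open>Finite additivity passes to the limit masses directly. Countable additivity of
    the limit is inherited later from Lebesgue measure.\<close>
  have m_split: "m k i = m (Suc k) (2 * i) + m (Suc k) (2 * i + 1)" for k i
  proof (rule LIMSEQ_unique[OF lim_m])
    have *: "cell k i = cell (Suc k) (2 * i) \<union> cell (Suc k) (2 * i + 1)"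
      "cell (Suc k) (2 * i) \<inter> cell (Suc k) (2 * i + 1) = {}"
      by (auto simp: cell_def q_Suc of_bool_def split: if_splits)
    have "measure (N (r n)) (cell k i) = measure (N (r n)) (cell (Suc k) (2 * i)) + measure (N (r n)) (cell (Suc k) (2 * i + 1))" for n
      unfolding *(1) by (rule N.finite_measure_Union[OF cell_sets cell_sets *(2)])
    then show "(\<lambda>n. measure (N (r n)) (cell k i)) \<longlonglongrightarrow> m (Suc k) (2 * i) + m (Suc k) (2 * i + 1)"
      by (simp only:) (intro tendsto_add lim_m)
  qed
  \<comment> \<open>Left endpoint of the interval assigned to code \<open>i\<close>: at level
    \<open>k\<close> the intervals of lengths \<open>m k i\<close> tile the unit interval in the
    order of the codes. By \<open>F_Suc\<close> the even endpoints of one level are the endpoints of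
    the previous level, which makes the intervals nested.\<close>
  define F where "F k i = (\<Sum>j<i. m k j)" for k i
  have F_Suc: "F (Suc k) (2 * i) = F k i" for k i
    unfolding F_def by (induction i) (auto simp: m_split[of k])
  have F_mono: "i \<le> j \<Longrightarrow> F k i \<le> F k j" for i j k
    unfolding F_def using m_nonneg by (intro sum_mono2) auto
  have F_0: "F k 0 = 0" for k by (simp add: F_def)
  have F_top: "F k (2 ^ k) = 1" for k
  proof (induction k)
    case 0
    have "cell 0 0 = space (N n)" for n by (auto simp: cell_def q_0 space_N)
    then have "measure (N n) (cell 0 0) = 1" for n using N.prob_space by metis
    then have "(\<lambda>n. measure (N (r n)) (cell 0 0)) \<longlonglongrightarrow> 1" by simp
    then have "m 0 0 = 1" using lim_m LIMSEQ_unique by blast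
    then show ?case by (simp add: F_def)
  qed (simp add: F_Suc)
  \<comment> \<open>The code of the level-\<open>k\<close> interval containing \<open>u\<close>.
    Codes of mass zero have empty intervals and are never selected.\<close>
  define J where "J k u = (LEAST i. u < F k (Suc i))" for k u
  have J_props: "F k (J k u) \<le> u \<and> u < F k (Suc (J k u)) \<and> J k u < 2 ^ k" if "u \<in> {0..<1}" for k u
  proof -
    have ex: "u < F k (Suc (2 ^ k - 1))" using that F_top[of k] by simp
    have "u < F k (Suc (J k u))" unfolding J_def by (rule LeastI[of _ "2^k - 1"], rule ex)
    moreover have "J k u \<le> 2 ^ k - 1" unfolding J_def by (rule Least_le[of _ "2^k - 1"], rule ex)
    then have "J k u < 2 ^ k" by (rule le_less_trans) simp
    moreover have "F k (J k u) \<le> u"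
    proof (cases "J k u")
      case (Suc i)
      then have "\<not> u < F k (Suc i)" using not_less_Least[of i "\<lambda>i. u < F k (Suc i)"] by (simp add: J_def)
      with Suc show ?thesis by simp
    qed (use that F_0 in simp)
    ultimately show ?thesis by blast
  qed
  have J_unique: "i = j" if "F k i \<le> u" "u < F k (Suc i)" "F k j \<le> u" "u < F k (Suc j)" for i j k u
    using that F_mono[of "Suc i" j k] F_mono[of "Suc j" i k] by (cases i j rule: linorder_cases) (simp_all add: Suc_le_eq)
  have J_div: "J (Suc k) u div 2 = J k u" if u: "u \<in> {0..<1}" for k u
  proof (rule J_unique)
    let ?i = "J (Suc k) u div 2"
    have "2 * ?i \<le> J (Suc k) u" "Suc (J (Suc k) u) \<le> 2 * Suc ?i" by presburger+
    then show "F k ?i \<le> u" "u < F k (Suc ?i)"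
      using J_props[OF u, of "Suc k"] F_mono[of "2 * ?i" "J (Suc k) u" "Suc k"]
         F_mono[of "Suc (J (Suc k) u)" "2 * Suc ?i" "Suc k"] unfolding F_Suc by linarith+
  qed (use J_props[OF u, of k] in auto)
  have J_set: "{u \<in> {0..<1}. J k u = i} = {F k i..<F k (Suc i)}" if "i < 2 ^ k" for k i
  proof -
    have "{F k i..<F k (Suc i)} \<subseteq> {0..<1}"
      using F_mono[of 0 i k] F_mono[of "Suc i" "2 ^ k" k] that by (auto simp: F_0 F_top)
    have "J k u = i" if "u \<in> {F k i..<F k (Suc i)}" for u
      using J_props[of u k] \<open>_ \<subseteq> {0..<1}\<close> that by (intro J_unique[of k _ u]) auto
    moreover have "u \<in> {F k i..<F k (Suc i)}" if "u \<in> {0..<1}" "J k u = i" for u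
      using J_props[of u k] that by simp
    ultimately show ?thesis using \<open>_ \<subseteq> {0..<1}\<close> by blast
  qed
  define c where "c k i = (SOME y. y \<in> cell k i)" for k i
  have c: "c k i \<in> cell k i" if "cell k i \<noteq> {}" for k i
    unfolding c_def using that by (auto intro: someI)
  define \<pi>' where "\<pi>' k u = c k (J k u)" for k u
  have \<pi>'_cell: "\<pi>' k u \<in> cell k (J k u)" if "u \<in> {0..<1}" for k u
  proof -
    \<comment> \<open>The interval containing \<open>u\<close> has positive length, so the limit
      mass is nonzero; hence the cell is nonempty and the choice made by \<open>c\<close> is a
      genuine point of it.\<close>
    have "m k (J k u) \<noteq> 0" using J_props[OF that, of k] by (auto simp: F_def)
    then have "cell k (J k u) \<noteq> {}" using lim_m[of k "J k u"] by (auto simp: LIMSEQ_const_iff)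
    then show ?thesis unfolding \<pi>'_def by (rule c)
  qed
  \<comment> \<open>All later representatives stay in the level-\<open>k\<close> cell of
    \<open>u\<close>, because \<open>J\<close> and \<open>q\<close> both forget a level by halving.
    This is what makes the representatives a Cauchy sequence.\<close>
  have q_\<pi>': "q k (\<pi>' (k + l) u) = J k u" if u: "u \<in> {0..<1}" for k l u
  proof -
    have "q k y = q (k + l) y div 2 ^ l" for y
      by (induction l) (simp_all add: div_mult2_eq q_div)
    moreover have "J k u = J (k + l) u div 2 ^ l"
      by (induction l) (simp_all add: div_mult2_eq J_div[OF u])
    moreover have "q (k + l) (\<pi>' (k + l) u) = J (k + l) u" using \<pi>'_cell[OF u] by (simp add: cell_def)
    ultimately show ?thesis by simp
  qed
  have fine: "\<exists>k. \<forall>y\<in>Y. \<forall>y'\<in>Y. q k y = q k y' \<longrightarrow> dist y y' < e" if "0 < e" for e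
    using B(2)[OF that] q_eq by meson
  have "\<exists>y\<in>Y. (\<lambda>k. \<pi>' k u) \<longlonglongrightarrow> y" if u: "u \<in> {0..<1}" for u
  proof -
    have inY: "\<pi>' k u \<in> Y" for k using \<pi>'_cell[OF u] by (auto simp: cell_def)
    have "Cauchy (\<lambda>k. \<pi>' k u)"
    proof (rule metric_CauchyI)
      fix e :: real assume "0 < e"
      then obtain k where "\<forall>y\<in>Y. \<forall>y'\<in>Y. q k y = q k y' \<longrightarrow> dist y y' < e" using fine by blast
      then show "\<exists>K. \<forall>m\<ge>K. \<forall>n\<ge>K. dist (\<pi>' m u) (\<pi>' n u) < e"
        using q_\<pi>'[OF u, of k] inY by (metis le_Suc_ex)
    qed
    then show ?thesis using inY completeE[OF compact_imp_complete[OF Y]] by metis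
  qed
  then obtain \<pi> where \<pi>: "\<And>u. u \<in> {0..<1} \<Longrightarrow> \<pi> u \<in> Y" "\<And>u. u \<in> {0..<1} \<Longrightarrow> (\<lambda>k. \<pi>' k u) \<longlonglongrightarrow> \<pi> u"
    by metis
  define \<Omega> where "\<Omega> = restrict_space lborel {0..<1::real}"
  have space_\<Omega>: "space \<Omega> = {0..<1}" by (simp add: \<Omega>_def space_restrict_space)
  interpret \<Omega>: prob_space \<Omega>
    by (rule prob_spaceI) (simp add: \<Omega>_def emeasure_restrict_space space_restrict_space)
  have J_meas: "J k \<in> \<Omega> \<rightarrow>\<^sub>M count_space UNIV" for k
  proof (rule measurable_count_space_eq2_countable[THEN iffD2], safe)
    fix i :: nat
    have "J k -` {i} \<inter> space \<Omega> = {u \<in> {0..<1}. J k u = i}" by (auto simp: space_\<Omega>)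
    moreover have "{u \<in> {0..<1}. J k u = i} = {}" if "\<not> i < 2 ^ k"
      using J_props[of _ k] that by blast
    ultimately have "J k -` {i} \<inter> space \<Omega> = (if i < 2 ^ k then {F k i..<F k (Suc i)} else {})"
      using J_set[of i k] by presburger
    moreover have "{F k i..<F k (Suc i)} \<subseteq> {0..<1}" if "i < 2 ^ k"
      using J_set[OF that] by blast
    ultimately show "J k -` {i} \<inter> space \<Omega> \<in> sets \<Omega>"
      by (auto simp: \<Omega>_def sets_restrict_space_iff)
  qed auto
  have \<pi>'_meas: "\<pi>' k \<in> borel_measurable \<Omega>" for k
    unfolding \<pi>'_def by (rule measurable_compose[OF J_meas]) simp
  have "\<pi> \<in> borel_measurable \<Omega>"
    by (rule borel_measurable_LIMSEQ_metric[where f = \<pi>', OF \<pi>'_meas]) (use \<pi>(2) space_\<Omega> in auto)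
  then have \<pi>_meas: "\<pi> \<in> \<Omega> \<rightarrow>\<^sub>M restrict_space borel Y"
    by (intro measurable_restrict_space2 funcsetI \<pi>(1)) (simp_all only: space_\<Omega>)
  define \<nu> where "\<nu> = distr \<Omega> (restrict_space borel Y) \<pi>"
  have J_prob: "measure \<Omega> (J k -` {i} \<inter> space \<Omega>) = m k i" if "i < 2 ^ k" for k i
  proof -
    have "J k -` {i} \<inter> space \<Omega> = {u \<in> {0..<1}. J k u = i}" by (auto simp: space_\<Omega>)
    then have *: "J k -` {i} \<inter> space \<Omega> = {F k i..<F k (Suc i)}" unfolding J_set[OF that] .
    have sub: "{F k i..<F k (Suc i)} \<subseteq> {0..<1}" using J_set[OF that] by blast
    have "measure \<Omega> {F k i..<F k (Suc i)} = measure lborel {F k i..<F k (Suc i)}"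
      unfolding \<Omega>_def using sub by (intro measure_restrict_space) simp_all
    also have "\<dots> = F k (Suc i) - F k i" using F_mono[of i "Suc i" k] by simp
    also have "\<dots> = m k i" by (simp add: F_def)
    finally show ?thesis unfolding * .
  qed
  have "(\<lambda>n. integral\<^sup>L (N (r n)) f) \<longlonglongrightarrow> integral\<^sup>L \<nu> f" if f: "continuous_on Y f" for f :: "'b \<Rightarrow> real"
  proof (rule LIMSEQ_I)
    fix e :: real assume "0 < e"
    \<comment> \<open>Three errors of this size occur: discretising the integral over
      \<open>N (r n)\<close>, discretising the integral over \<nu>, and the convergence of finitely
      many cell masses.\<close>
    define e' where "e' = e / 4"
    have "0 < e'" using \<open>0 < e\<close> by (simp add: e'_def)
    have f_meas: "f \<in> borel_measurable (restrict_space borel Y)"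
      using f by (rule borel_measurable_continuous_on_restrict)
    obtain D where D: "\<And>y. y \<in> Y \<Longrightarrow> \<bar>f y\<bar> \<le> D"
      using compact_imp_bounded[OF compact_continuous_image[OF f Y]] by (auto simp: bounded_iff)
    have "uniformly_continuous_on Y f" using f Y by (intro compact_uniformly_continuous)
    then obtain d where d: "0 < d" "\<And>x y. x \<in> Y \<Longrightarrow> y \<in> Y \<Longrightarrow> dist y x < d \<Longrightarrow> dist (f y) (f x) < e'"
      using \<open>0 < e'\<close> unfolding uniformly_continuous_on_def by metis
    \<comment> \<open>Points of one cell are closer than \<open>d / 2\<close>. The limit point
      \<open>\<pi> u\<close> may leave the cell, but it remains within \<open>d / 2\<close>, hence
      strictly within \<open>d\<close>, of the representative.\<close>
    obtain k where k: "\<And>y y'. y \<in> Y \<Longrightarrow> y' \<in> Y \<Longrightarrow> q k y = q k y' \<Longrightarrow> dist y y' < d / 2"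
      using fine[of "d / 2"] d(1) by auto
    define g where "g i = f (c k i)" for i
    have N_approx: "\<bar>integral\<^sup>L (N n) f - (\<Sum>i<2 ^ k. measure (N n) (cell k i) * g i)\<bar> \<le> e'" for n
    proof -
      have int_f: "integrable (N n) f"
        by (rule N.integrable_const_bound[where B = D])
          (use D f_meas in \<open>auto simp: space_N measurable_cong_sets[OF sets_N refl]\<close>)
      have "q k \<in> N n \<rightarrow>\<^sub>M count_space UNIV"
        using q_meas by (simp add: measurable_cong_sets[OF sets_N refl])
      moreover have "q k y < 2 ^ k \<and> \<bar>f y - g (q k y)\<bar> \<le> e'" if "y \<in> space (N n)" for y
      proof -
        have y: "y \<in> Y" "y \<in> cell k (q k y)" using that by (auto simp: space_N cell_def)
        have "c k (q k y) \<in> cell k (q k y)" using y by (intro c) auto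
        then have "dist (f y) (f (c k (q k y))) < e'"
          using y d(1) k[of y "c k (q k y)"] by (intro d(2)) (auto simp: cell_def)
        then show ?thesis using q_less by (simp add: g_def dist_real_def)
      qed
      ultimately have "\<bar>integral\<^sup>L (N n) f - (\<Sum>i<2 ^ k. measure (N n) {y \<in> space (N n). q k y = i} * g i)\<bar> \<le> e'"
        by (rule N.integral_approx_by_level_sets[OF int_f])
      then show ?thesis by (simp add: cell_def space_N)
    qed
    have \<nu>_approx: "\<bar>integral\<^sup>L \<nu> f - (\<Sum>i<2 ^ k. m k i * g i)\<bar> \<le> e'"
    proof -
      have "integral\<^sup>L \<nu> f = (\<integral>u. f (\<pi> u) \<partial>\<Omega>)"
        unfolding \<nu>_def by (rule integral_distr[OF \<pi>_meas f_meas])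
      have int_f: "integrable \<Omega> (\<lambda>u. f (\<pi> u))"
        by (rule \<Omega>.integrable_const_bound[where B = D])
          (use D \<pi>(1) measurable_compose[OF \<pi>_meas f_meas] in \<open>auto simp: space_\<Omega>\<close>)
      have "J k u < 2 ^ k \<and> \<bar>f (\<pi> u) - g (J k u)\<bar> \<le> e'" if "u \<in> space \<Omega>" for u
      proof -
        have u: "u \<in> {0..<1}" using that by (simp add: space_\<Omega>)
        have inY: "\<pi>' l u \<in> Y" for l using \<pi>'_cell[OF u] by (auto simp: cell_def)
        have "dist (\<pi>' (k + l) u) (\<pi>' k u) \<le> d / 2" for l
          using k[of "\<pi>' (k + l) u" "\<pi>' k u"] inY q_\<pi>'[OF u, of k l] q_\<pi>'[OF u, of k 0] by simp
        moreover have "(\<lambda>l. dist (\<pi>' (k + l) u) (\<pi>' k u)) \<longlonglongrightarrow> dist (\<pi> u) (\<pi>' k u)"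
          using LIMSEQ_ignore_initial_segment[OF \<pi>(2)[OF u], of k] by (intro tendsto_intros) (simp add: add.commute)
        ultimately have "dist (\<pi> u) (\<pi>' k u) \<le> d / 2"
          by (intro LIMSEQ_le_const2[where X = "\<lambda>l. dist (\<pi>' (k + l) u) (\<pi>' k u)"]) auto
        then have "dist (f (\<pi> u)) (f (\<pi>' k u)) < e'"
          using d(1) inY \<pi>(1)[OF u] by (intro d(2)) auto
        then show ?thesis
          using J_props[OF u, of k] by (simp add: g_def \<pi>'_def dist_real_def)
      qed
      then have "\<bar>(\<integral>u. f (\<pi> u) \<partial>\<Omega>) - (\<Sum>i<2 ^ k. measure \<Omega> {u \<in> space \<Omega>. J k u = i} * g i)\<bar> \<le> e'"
        by (rule \<Omega>.integral_approx_by_level_sets[OF int_f J_meas])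
      moreover have "{u \<in> space \<Omega>. J k u = i} = J k -` {i} \<inter> space \<Omega>" for i by auto
      ultimately show ?thesis by (simp add: J_prob \<open>integral\<^sup>L \<nu> f = _\<close>)
    qed
    have "(\<lambda>n. \<Sum>i<2 ^ k. measure (N (r n)) (cell k i) * g i) \<longlonglongrightarrow> (\<Sum>i<2 ^ k. m k i * g i)"
      by (intro tendsto_intros lim_m)
    then obtain n0 where n0: "\<And>n. n0 \<le> n \<Longrightarrow>
        norm ((\<Sum>i<2 ^ k. measure (N (r n)) (cell k i) * g i) - (\<Sum>i<2 ^ k. m k i * g i)) < e'"
      using LIMSEQ_D \<open>0 < e'\<close> by blast
    then have "norm (integral\<^sup>L (N (r n)) f - integral\<^sup>L \<nu> f) < e" if "n0 \<le> n" for n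
      using n0[OF that] N_approx[of "r n"] \<nu>_approx by (auto simp: e'_def abs_if split: if_splits)
    then show "\<exists>n0. \<forall>n\<ge>n0. norm (integral\<^sup>L (N (r n)) f - integral\<^sup>L \<nu> f) < e" by blast
  qed
  moreover have "prob_space \<nu>" unfolding \<nu>_def by (rule \<Omega>.prob_space_distr[OF \<pi>_meas])
  moreover have "sets \<nu> = sets (restrict_space borel Y)" by (simp add: \<nu>_def)
  ultimately show thesis using that r by blast
qed

section \<open>The suspension flow\<close>

locale roof_system =
  fixes X :: "'a::metric_space set" and T :: "'a \<Rightarrow> 'a" and \<tau> :: "'a \<Rightarrow> real"
  assumes compact_X: "compact X" and X_nonempty: "X \<noteq> {}"
    and cont_T: "continuous_on X T" and T_X: "T ` X \<subseteq> X"
    and cont_\<tau>: "continuous_on X \<tau>" and \<tau>_pos: "\<And>x. x \<in> X \<Longrightarrow> 0 < \<tau> x"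
begin

abbreviation "sdom \<equiv> susp_dom X \<tau>"
abbreviation "cdom \<equiv> susp_closed X \<tau>"
abbreviation "\<theta> \<equiv> susp_flow T \<tau>"

section \<open>Return times to the base and the flow in coordinates\<close>

definition roof_sum :: "nat \<Rightarrow> 'a \<Rightarrow> real" where
  "roof_sum n x = (\<Sum>i<n. \<tau> ((T ^^ i) x))"

definition roof_min :: real where "roof_min = (SOME c. 0 < c \<and> (\<forall>x\<in>X. c \<le> \<tau> x))"
definition roof_max :: real where "roof_max = (SOME c. \<forall>x\<in>X. \<tau> x \<le> c)"

lemma roof_min: "0 < roof_min" "x \<in> X \<Longrightarrow> roof_min \<le> \<tau> x"
proof -
  obtain y where "y \<in> X" "\<forall>x\<in>X. \<tau> y \<le> \<tau> x"
    using continuous_attains_inf[OF compact_X X_nonempty cont_\<tau>] by blast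
  then have "\<exists>c. 0 < c \<and> (\<forall>x\<in>X. c \<le> \<tau> x)" using \<tau>_pos by blast
  then have "0 < roof_min \<and> (\<forall>x\<in>X. roof_min \<le> \<tau> x)" unfolding roof_min_def by (rule someI_ex)
  then show "0 < roof_min" "x \<in> X \<Longrightarrow> roof_min \<le> \<tau> x" by auto
qed

lemma roof_max: "x \<in> X \<Longrightarrow> \<tau> x \<le> roof_max"
proof -
  obtain y where "y \<in> X" "\<forall>x\<in>X. \<tau> x \<le> \<tau> y"
    using continuous_attains_sup[OF compact_X X_nonempty cont_\<tau>] by blast
  then have "\<exists>c. \<forall>x\<in>X. \<tau> x \<le> c" by blast
  then have "\<forall>x\<in>X. \<tau> x \<le> roof_max" unfolding roof_max_def by (rule someI_ex)
  then show "x \<in> X \<Longrightarrow> \<tau> x \<le> roof_max" by auto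
qed

lemma funpow_X: "x \<in> X \<Longrightarrow> (T ^^ n) x \<in> X"
  using funpow_in_set[OF T_X] .

lemma sdom_subset: "sdom \<subseteq> cdom"
  by (auto simp: susp_dom_def susp_closed_def)

lemma base_in_sdom: "x \<in> X \<Longrightarrow> (x, 0) \<in> sdom"
  using \<tau>_pos by (simp add: susp_dom_def)

lemma roof_sum_Suc: "roof_sum (Suc n) x = roof_sum n x + \<tau> ((T ^^ n) x)"
  by (simp add: roof_sum_def)

lemma roof_sum_add: "roof_sum (n + k) x = roof_sum n x + roof_sum k ((T ^^ n) x)"
  unfolding roof_sum_def sum_lessThan_add by (simp add: funpow_add add.commute[of n])

lemma roof_sum_ge: "x \<in> X \<Longrightarrow> real n * roof_min \<le> roof_sum n x"
  unfolding roof_sum_def using sum_mono[of "{..<n}" "\<lambda>_. roof_min" "\<lambda>i. \<tau> ((T ^^ i) x)"] roof_min funpow_X by simp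

lemma roof_sum_nonneg: "x \<in> X \<Longrightarrow> 0 \<le> roof_sum n x"
  unfolding roof_sum_def using \<tau>_pos funpow_X by (intro sum_nonneg) (auto intro: less_imp_le)

lemma roof_sum_mono: "x \<in> X \<Longrightarrow> m \<le> n \<Longrightarrow> roof_sum m x \<le> roof_sum n x"
  unfolding roof_sum_def using \<tau>_pos funpow_X by (intro sum_mono2) (auto intro: less_imp_le)

lemma roof_index:
  assumes "x \<in> X" "0 \<le> r"
  obtains n where "roof_sum n x \<le> r" "r < roof_sum (Suc n) x"
proof -
  obtain k :: nat where "r / roof_min < real k" using reals_Archimedean2 by blast
  then have "r < real k * roof_min" using roof_min by (simp add: field_simps)
  also have "\<dots> \<le> roof_sum k x" using assms(1) by (rule roof_sum_ge)
  also have "\<dots> \<le> roof_sum (Suc k) x" using assms(1) by (intro roof_sum_mono) auto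
  finally have *: "r < roof_sum (Suc k) x" .
  define n where "n = (LEAST n. r < roof_sum (Suc n) x)"
  have "r < roof_sum (Suc n) x" unfolding n_def using * by (rule LeastI)
  moreover have "roof_sum n x \<le> r"
  proof (cases n)
    case 0
    then show ?thesis using assms by (simp add: roof_sum_def)
  next
    case (Suc m)
    then show ?thesis using not_less_Least[of m "\<lambda>n. r < roof_sum (Suc n) x"] by (simp add: n_def)
  qed
  ultimately show thesis using that by blast
qed

text \<open>Any index bracketing the elapsed height is the least index used in
  \<open>susp_flow\<close>, because the roof sums increase; the \<open>LEAST\<close> can then be
  avoided.\<close>

lemma flow_eq:
  assumes "x \<in> X" "roof_sum n x \<le> s + t" "s + t < roof_sum (Suc n) x"
  shows "\<theta> t (x, s) = ((T ^^ n) x, s + t - roof_sum n x)"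
proof -
  have "(LEAST n. s + t < roof_sum (Suc n) x) = n"
  proof (rule Least_equality)
    fix m assume "s + t < roof_sum (Suc m) x"
    then show "n \<le> m" using assms roof_sum_mono[of x "Suc m" n] by (meson leD le_less_trans not_less_eq_eq)
  qed (rule assms)
  then show ?thesis by (simp add: susp_flow_def Let_def roof_sum_def)
qed

lemma flow_shift: "\<theta> t (x, s) = \<theta> (s + t) (x, 0)"
  by (simp add: susp_flow_def)

lemma flow_cases:
  assumes "x \<in> X" "0 \<le> s + t"
  obtains n where "roof_sum n x \<le> s + t" "s + t < roof_sum (Suc n) x"
    "\<theta> t (x, s) = ((T ^^ n) x, s + t - roof_sum n x)"
  using roof_index[OF assms] flow_eq[OF assms(1)] by metis

lemma flow_in_sdom: "p \<in> cdom \<Longrightarrow> 0 \<le> t \<Longrightarrow> \<theta> t p \<in> sdom"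
proof -
  assume "p \<in> cdom" "0 \<le> t"
  then obtain x s where p: "p = (x, s)" "x \<in> X" "0 \<le> s + t" by (auto simp: susp_closed_def)
  then obtain n where "roof_sum n x \<le> s + t" "s + t < roof_sum (Suc n) x"
    "\<theta> t (x, s) = ((T ^^ n) x, s + t - roof_sum n x)" using flow_cases by blast
  then show ?thesis using p funpow_X by (auto simp: susp_dom_def roof_sum_Suc)
qed

lemma flow_add:
  assumes "p \<in> cdom" "0 \<le> t" "0 \<le> u"
  shows "\<theta> (t + u) p = \<theta> u (\<theta> t p)"
proof -
  obtain x s where p: "p = (x, s)" "x \<in> X" "0 \<le> s" using assms by (auto simp: susp_closed_def)
  obtain n where n: "roof_sum n x \<le> s + t" "s + t < roof_sum (Suc n) x"
    "\<theta> t (x, s) = ((T ^^ n) x, s + t - roof_sum n x)"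
    using flow_cases[of x s t] assms p by auto
  let ?y = "(T ^^ n) x" and ?r = "s + t - roof_sum n x"
  have "?y \<in> X" using funpow_X p by blast
  then obtain k where k: "roof_sum k ?y \<le> ?r + u" "?r + u < roof_sum (Suc k) ?y"
    "\<theta> u (?y, ?r) = ((T ^^ k) ?y, ?r + u - roof_sum k ?y)"
    using flow_cases[of ?y ?r u] assms n(1) by auto
  have "\<theta> (t + u) (x, s) = ((T ^^ (n + k)) x, s + (t + u) - roof_sum (n + k) x)"
    using k(1,2) roof_sum_add[of n k x] roof_sum_add[of n "Suc k" x] p(2) by (intro flow_eq) auto
  also have "\<dots> = ((T ^^ k) ?y, ?r + u - roof_sum k ?y)"
    using funpow_add[of k n T] by (simp add: roof_sum_add[of n k] add.commute[of k n])
  finally show ?thesis using n k p by simp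
qed

lemma flow_0: "p \<in> sdom \<Longrightarrow> \<theta> 0 p = p"
proof -
  assume "p \<in> sdom"
  then obtain x s where "p = (x, s)" "x \<in> X" "0 \<le> s" "s < \<tau> x" by (auto simp: susp_dom_def)
  then show ?thesis using flow_eq[of x 0 s 0] by (simp add: roof_sum_def)
qed

lemma flow_glue: "x \<in> X \<Longrightarrow> 0 \<le> t \<Longrightarrow> \<theta> t (x, \<tau> x) = \<theta> t (T x, 0)"
proof -
  assume x: "x \<in> X" and t: "0 \<le> t"
  then have "T x \<in> X" using T_X by blast
  then obtain n where n: "roof_sum n (T x) \<le> t" "t < roof_sum (Suc n) (T x)"
    "\<theta> t (T x, 0) = ((T ^^ n) (T x), t - roof_sum n (T x))"
    using flow_cases[of "T x" 0 t] t by auto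
  have eq: "roof_sum (Suc m) x = \<tau> x + roof_sum m (T x)" for m
    using roof_sum_add[of 1 m x] by (simp add: roof_sum_def)
  have "\<theta> t (x, \<tau> x) = ((T ^^ Suc n) x, \<tau> x + t - roof_sum (Suc n) x)"
    using x n by (intro flow_eq) (auto simp: eq)
  then show ?thesis using n by (simp add: eq funpow_swap1)
qed

text \<open>Time zero is not the identity on the closed domain: \<open>\<theta> 0\<close> sends a
  roof point \<open>(x, \<tau> x)\<close> to its canonical representative \<open>(T x, 0)\<close>.
  Compatible functions take the same value at both.\<close>

lemma susp_cont_flow_0: "susp_cont X T \<tau> f \<Longrightarrow> p \<in> cdom \<Longrightarrow> f (\<theta> 0 p) = f p"
proof -
  assume f: "susp_cont X T \<tau> f" and "p \<in> cdom"
  then obtain x s where p: "p = (x, s)" "x \<in> X" "0 \<le> s" "s \<le> \<tau> x" by (auto simp: susp_closed_def)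
  show ?thesis
  proof (cases "s = \<tau> x")
    case True
    then have "\<theta> 0 p = \<theta> 0 (T x, 0)" using p flow_glue by simp
    also have "\<dots> = (T x, 0)" using p T_X by (intro flow_0 base_in_sdom) auto
    finally show ?thesis using f p True by (simp add: susp_cont_def)
  next
    case False
    then show ?thesis using p by (subst flow_0) (auto simp: susp_dom_def)
  qed
qed

section \<open>Continuity on the closed domain and integrals along orbits\<close>

lemma compact_cdom: "compact cdom"
proof -
  have "continuous_on (X \<times> {0..1}) (\<lambda>(x, u). (x, u * \<tau> x))"
    unfolding case_prod_unfold
    by (intro continuous_intros continuous_on_compose2[OF cont_\<tau>]) auto
  then have "compact ((\<lambda>(x, u). (x, u * \<tau> x)) ` (X \<times> {0..1}))"
    using compact_X by (intro compact_continuous_image compact_Times) auto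
  also have "(\<lambda>(x, u). (x, u * \<tau> x)) ` (X \<times> {0..1}) = cdom"
  proof (intro equalityI subsetI)
    fix p assume "p \<in> cdom"
    then obtain x s where p: "p = (x, s)" "x \<in> X" "0 \<le> s" "s \<le> \<tau> x" by (auto simp: susp_closed_def)
    then have "p = (\<lambda>(x, u). (x, u * \<tau> x)) (x, s / \<tau> x)" "s / \<tau> x \<in> {0..1}"
      using \<tau>_pos[of x] by auto
    then show "p \<in> (\<lambda>(x, u). (x, u * \<tau> x)) ` (X \<times> {0..1})" using p by blast
  qed (use \<tau>_pos in \<open>force simp: susp_closed_def mult_left_le_one_le\<close>)
  finally show ?thesis .
qed

lemma continuous_on_base:
  assumes "continuous_on X g"
  shows "continuous_on cdom (\<lambda>p. g (fst p))"
  by (rule continuous_on_compose2[OF assms]) (auto intro: continuous_intros simp: susp_closed_def)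

lemma continuous_on_funpow_base: "continuous_on cdom (\<lambda>p. (T ^^ n) (fst p))"
  using continuous_on_base continuous_on_funpow[OF cont_T T_X] by blast

lemma continuous_on_roof_sum: "continuous_on X (roof_sum n)"
  unfolding roof_sum_def using funpow_X
  by (intro continuous_intros continuous_on_compose2[OF cont_\<tau> continuous_on_funpow[OF cont_T T_X]]) auto

lemma bounded_on_cdom:
  assumes "continuous_on cdom (f :: 'a \<times> real \<Rightarrow> real)"
  obtains B where "0 \<le> B" "\<And>p. p \<in> cdom \<Longrightarrow> \<bar>f p\<bar> \<le> B"
proof -
  obtain B where "0 < B" "\<And>p. p \<in> cdom \<Longrightarrow> \<bar>f p\<bar> \<le> B"
    using compact_imp_bounded[OF compact_continuous_image[OF assms compact_cdom]] by (auto simp: bounded_pos)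
  then show thesis using that[of B] by simp
qed

text \<open>The observable on the base whose Birkhoff sums are the orbit integrals of
  \<open>f\<close> from the base up to successive return times.\<close>

definition fibre_integral :: "('a \<times> real \<Rightarrow> real) \<Rightarrow> 'a \<Rightarrow> real" where
  "fibre_integral f x = integral {0..\<tau> x} (\<lambda>s. f (x, s))"

lemma continuous_on_fibre:
  assumes "continuous_on cdom f" "x \<in> X"
  shows "continuous_on {0..\<tau> x} (\<lambda>s. f (x, s))"
  by (rule continuous_on_compose2[OF assms(1)]) (use assms(2) in \<open>auto intro!: continuous_intros simp: susp_closed_def\<close>)

text \<open>Rescaling each fibre to the unit interval removes the endpoint that varies with
  \<open>x\<close>, so continuity of parameter integrals over a fixed interval applies.\<close>

lemma continuous_on_fibre_integral:
  assumes f: "continuous_on cdom f"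
  shows "continuous_on X (fibre_integral f)"
proof -
  have "continuous_on (X \<times> cbox 0 1) (\<lambda>(x, u). f (x, u * \<tau> x))"
    unfolding case_prod_unfold using \<tau>_pos
    by (intro continuous_on_compose2[OF f] continuous_intros continuous_on_compose2[OF cont_\<tau>])
      (force simp: susp_closed_def mult_left_le_one_le)+
  then have *: "continuous_on X (\<lambda>x. \<tau> x * integral (cbox 0 1) (\<lambda>u. f (x, u * \<tau> x)))"
    by (intro continuous_on_mult cont_\<tau> integral_continuous_on_param)
  have "fibre_integral f x = \<tau> x * integral (cbox 0 1) (\<lambda>u. f (x, u * \<tau> x))" if x: "x \<in> X" for x
  proof -
    have "((\<lambda>s. f (x, s)) has_integral fibre_integral f x) (cbox 0 (\<tau> x))"
      unfolding fibre_integral_def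
      using integrable_integral[OF integrable_continuous_interval[OF continuous_on_fibre[OF f x]]] by simp
    from has_integral_affinity'[OF this \<tau>_pos[OF x], of 0] \<tau>_pos[OF x]
    have "((\<lambda>u. f (x, u * \<tau> x)) has_integral fibre_integral f x / \<tau> x) (cbox 0 1)"
      by (simp add: mult.commute divide_inverse)
    then show ?thesis using \<tau>_pos[OF x] by (simp add: integral_unique)
  qed
  then show ?thesis using * by (simp cong: continuous_on_cong)
qed

lemma orbit_piece_has_integral:
  assumes f: "continuous_on cdom f" and x: "x \<in> X"
  shows "((\<lambda>u. f (\<theta> u (x, 0))) has_integral fibre_integral f ((T ^^ n) x)) {roof_sum n x..roof_sum (Suc n) x}"
\<comment> \<open>At the right endpoint the flow has already jumped to the next fibre; a single
  point does not change the integral.\<close>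
proof (rule has_integral_spike_finite[where S = "{roof_sum (Suc n) x}"])
  let ?y = "(T ^^ n) x"
  have "((\<lambda>s. f (?y, s)) has_integral fibre_integral f ?y) {0..\<tau> ?y}"
    unfolding fibre_integral_def
    using integrable_integral[OF integrable_continuous_interval[OF continuous_on_fibre[OF f funpow_X[OF x]]]] .
  then have "(((\<lambda>u. f (?y, u - roof_sum n x)) \<circ> (+) (roof_sum n x)) has_integral fibre_integral f ?y) {0..\<tau> ?y}"
    by (simp add: o_def)
  then show "((\<lambda>u. f (?y, u - roof_sum n x)) has_integral fibre_integral f ?y) {roof_sum n x..roof_sum (Suc n) x}"
    unfolding has_integral_shift_Icc_real by (simp add: roof_sum_Suc add.commute)
  fix u assume "u \<in> {roof_sum n x..roof_sum (Suc n) x} - {roof_sum (Suc n) x}"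
  then show "f (\<theta> u (x, 0)) = f (?y, u - roof_sum n x)"
    using flow_eq[OF x, of n 0 u] by simp
qed simp

lemma orbit_has_integral:
  assumes f: "continuous_on cdom f" and x: "x \<in> X"
  shows "((\<lambda>u. f (\<theta> u (x, 0))) has_integral (\<Sum>i<n. fibre_integral f ((T ^^ i) x))) {0..roof_sum n x}"
proof (induction n)
  case (Suc n)
  show ?case unfolding sum.lessThan_Suc
    by (rule has_integral_combine[OF _ _ Suc orbit_piece_has_integral[OF f x]])
      (use roof_sum_nonneg[OF x] roof_sum_mono[OF x] in auto)
qed (use has_integral_refl(2)[of _ "0::real"] in \<open>simp add: roof_sum_def\<close>)

lemma orbit_integrable:
  fixes f :: "'a \<times> real \<Rightarrow> real"
  assumes f: "continuous_on cdom f" and x: "x \<in> X" and "0 \<le> a"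
  shows "(\<lambda>u. f (\<theta> u (x, 0))) integrable_on {a..b}"
proof (cases "a \<le> b")
  case True
  then obtain n where "b < roof_sum (Suc n) x" using roof_index[OF x, of b] assms by auto
  then show ?thesis
    using orbit_has_integral[OF f x, of "Suc n"] \<open>0 \<le> a\<close>
    by (intro integrable_on_subinterval[of _ "{0..roof_sum (Suc n) x}" a b]) (auto simp: integrable_on_def)
qed auto

lemma orbit_integral_shift:
  fixes f :: "'a \<times> real \<Rightarrow> real"
  shows   "integral {a..b} (\<lambda>u. f (\<theta> u (x, s))) = integral {a + s..b + s} (\<lambda>u. f (\<theta> u (x, 0)))"
  using integral_shift_Icc_real[of a b "\<lambda>u. f (\<theta> u (x, 0))" s] by (simp add: o_def flow_shift[of _ x s])

lemma orbit_integrable':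
  fixes f :: "'a \<times> real \<Rightarrow> real"
  assumes f: "continuous_on cdom f" and p: "p \<in> cdom" and "0 \<le> a"
  shows "(\<lambda>u. f (\<theta> u p)) integrable_on {a..b}"
proof -
  obtain x s where ps: "p = (x, s)" "x \<in> X" "0 \<le> s" using p by (auto simp: susp_closed_def)
  have "((\<lambda>u. f (\<theta> u (x, 0))) \<circ> (+) s) integrable_on {a..b}"
    using orbit_integrable[OF f ps(2), of "a + s" "b + s"] ps(3) \<open>0 \<le> a\<close> integrable_on_shift_Icc_real by force
  then show ?thesis by (simp add: o_def ps(1) flow_shift[of _ x s])
qed

lemma orbit_integral_bound:
  fixes f :: "'a \<times> real \<Rightarrow> real"
  assumes f: "continuous_on cdom f" and B: "\<And>q. q \<in> cdom \<Longrightarrow> \<bar>f q\<bar> \<le> B"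
    and p: "p \<in> cdom" and ab: "0 \<le> a" "a \<le> b"
  shows "\<bar>integral {a..b} (\<lambda>u. f (\<theta> u p))\<bar> \<le> B * (b - a)"
proof -
  have "norm (integral (cbox a b) (\<lambda>u. f (\<theta> u p))) \<le> B * Henstock_Kurzweil_Integration.content (cbox a b)"
  proof (rule integrable_bound)
    show "0 \<le> B" using B[OF p] by linarith
    show "(\<lambda>u. f (\<theta> u p)) integrable_on cbox a b" using orbit_integrable'[OF f p ab(1)] by simp
    fix u assume "u \<in> cbox a b"
    then have "\<theta> u p \<in> cdom" using flow_in_sdom[OF p, of u] sdom_subset ab(1) by auto
    then show "norm (f (\<theta> u p)) \<le> B" using B by simp
  qed
  then show ?thesis using ab(2) by simp
qed

text \<open>Extend the orbit piece backwards to the base of its first fibre and cut it at its last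
  return: complete fibres remain, and each of the two corrections has length at most
  \<open>roof_max\<close>.\<close>

lemma orbit_integral_approx:
  fixes f :: "'a \<times> real \<Rightarrow> real"
  assumes f: "continuous_on cdom f" and B: "\<And>q. q \<in> cdom \<Longrightarrow> \<bar>f q\<bar> \<le> B"
    and xs: "(x, s) \<in> cdom" and t: "0 \<le> t"
  obtains n where "roof_sum n x \<le> s + t" "s + t < roof_sum (Suc n) x"
    "\<bar>integral {0..t} (\<lambda>u. f (\<theta> u (x, s))) - (\<Sum>i<n. fibre_integral f ((T ^^ i) x))\<bar> \<le> 2 * B * roof_max"
proof -
  have x: "x \<in> X" and s: "0 \<le> s" "s \<le> \<tau> x" using xs by (auto simp: susp_closed_def)
  obtain n where n: "roof_sum n x \<le> s + t" "s + t < roof_sum (Suc n) x"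
    using roof_index[OF x, of "s + t"] s t by auto
  let ?G = "\<lambda>u. f (\<theta> u (x, 0))"
  have xin: "(x, 0) \<in> cdom" using base_in_sdom[OF x] sdom_subset by blast
  have B0: "0 \<le> B" using B[OF xin] by linarith
  have "integral {0..s} ?G + integral {s..s + t} ?G = integral {0..s + t} ?G"
    using s t by (intro Henstock_Kurzweil_Integration.integral_combine orbit_integrable[OF f x]) auto
  moreover have "integral {0..roof_sum n x} ?G + integral {roof_sum n x..s + t} ?G = integral {0..s + t} ?G"
    using n(1) roof_sum_nonneg[OF x]
    by (intro Henstock_Kurzweil_Integration.integral_combine orbit_integrable[OF f x]) auto
  moreover have "integral {0..roof_sum n x} ?G = (\<Sum>i<n. fibre_integral f ((T ^^ i) x))"
    using orbit_has_integral[OF f x] by (rule integral_unique)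
  moreover have "integral {0..t} (\<lambda>u. f (\<theta> u (x, s))) = integral {s..s + t} ?G"
    using orbit_integral_shift[of 0 t f x s] by (simp add: add.commute)
  moreover have "\<bar>integral {0..s} ?G\<bar> \<le> B * roof_max"
  proof -
    have "\<bar>integral {0..s} ?G\<bar> \<le> B * (s - 0)" by (rule orbit_integral_bound[OF f B xin]) (use s in auto)
    also have "\<dots> \<le> B * roof_max" using B0 s roof_max[OF x] by (intro mult_left_mono) auto
    finally show ?thesis .
  qed
  moreover have "\<bar>integral {roof_sum n x..s + t} ?G\<bar> \<le> B * roof_max"
  proof -
    have "\<bar>integral {roof_sum n x..s + t} ?G\<bar> \<le> B * (s + t - roof_sum n x)"
      by (rule orbit_integral_bound[OF f B xin]) (use n roof_sum_nonneg[OF x] in auto)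
    also have "\<dots> \<le> B * roof_max"
      using B0 n roof_max[OF funpow_X[OF x, of n]] by (intro mult_left_mono) (auto simp: roof_sum_Suc)
    finally show ?thesis .
  qed
  ultimately show thesis using that[OF n] by linarith
qed

section \<open>Empirical measures\<close>

abbreviation "bor \<equiv> restrict_space borel sdom"
abbreviation "cbor \<equiv> restrict_space borel cdom"

section \<open>Measurability of the flow\<close>

lemma flow_measurable:
  assumes "0 \<le> t"
  shows "\<theta> t \<in> cbor \<rightarrow>\<^sub>M bor"
proof (rule measurable_restrict_space2)
  have [measurable]: "(\<lambda>p. roof_sum n (fst p)) \<in> borel_measurable cbor" for n
    by (intro borel_measurable_continuous_on_restrict continuous_on_base continuous_on_roof_sum)
  have [measurable]: "snd \<in> borel_measurable cbor"
    by (intro borel_measurable_continuous_on_restrict continuous_intros)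
  \<comment> \<open>For a fixed number \<open>n\<close> of roof crossings the formula is continuous;
    the actual number is a measurable function with countably many values.\<close>
  have "(\<lambda>p. ((T ^^ n) (fst p), snd p + t - roof_sum n (fst p))) \<in> borel_measurable cbor" for n
    by (intro borel_measurable_continuous_on_restrict continuous_on_Pair continuous_on_funpow_base
        continuous_intros continuous_on_base continuous_on_roof_sum)
  moreover have "(\<lambda>p. LEAST n. snd p + t < roof_sum (Suc n) (fst p)) \<in> cbor \<rightarrow>\<^sub>M count_space UNIV"
    by measurable
  ultimately have "(\<lambda>p. (\<lambda>n p. ((T ^^ n) (fst p), snd p + t - roof_sum n (fst p)))
      (LEAST n. snd p + t < roof_sum (Suc n) (fst p)) p) \<in> borel_measurable cbor"
    by (rule measurable_compose_countable)
  then show "\<theta> t \<in> borel_measurable cbor"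
    by (simp add: susp_flow_def[abs_def] Let_def roof_sum_def)
  show "\<theta> t \<in> space cbor \<rightarrow> sdom"
    using flow_in_sdom assms by (auto simp: space_restrict_space)
qed

text \<open>Canonical representatives jump when the orbit meets the roof, so orbits in the
  fundamental domain are continuous only from the right. Times approaching from above eventually see
  the same number of crossings.\<close>

lemma flow_right_continuous:
  assumes p: "p \<in> cdom" and u: "0 \<le> u" and v: "\<And>k. u \<le> v k" "v \<longlonglongrightarrow> u"
  shows "(\<lambda>k. \<theta> (v k) p) \<longlonglongrightarrow> \<theta> u p"
proof -
  obtain x s where ps: "p = (x, s)" "x \<in> X" "0 \<le> s" using p by (auto simp: susp_closed_def)
  obtain n where n: "roof_sum n x \<le> s + u" "s + u < roof_sum (Suc n) x"
    "\<theta> u (x, s) = ((T ^^ n) x, s + u - roof_sum n x)" using flow_cases[of x s u] ps u by auto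
  have "\<forall>\<^sub>F k in sequentially. v k < roof_sum (Suc n) x - s"
    using n(2) by (intro order_tendstoD(2)[OF v(2)]) simp
  then have "\<forall>\<^sub>F k in sequentially. ((T ^^ n) x, s + v k - roof_sum n x) = \<theta> (v k) p"
    by eventually_elim (use n(1) v(1) ps in \<open>auto simp: flow_eq[of x n s] add_left_mono order_trans\<close>)
  moreover have "(\<lambda>k. ((T ^^ n) x, s + v k - roof_sum n x)) \<longlonglongrightarrow> \<theta> u p"
    unfolding ps(1) n(3) by (intro tendsto_intros v(2))
  ultimately show ?thesis by (rule Lim_transform_eventually[rotated])
qed

text \<open>Joint measurability in time and point is needed for Fubini and for the law of an orbit.
  Rounding the time to a grid leaves countably many fixed-time maps, and right continuity carries
  measurability to the limit. Negative times are cut off at 0 to obtain a map on all of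
  \<real>.\<close>

lemma flow_measurable_pair: "(\<lambda>z. \<theta> (max 0 (fst z)) (snd z)) \<in> borel \<Otimes>\<^sub>M cbor \<rightarrow>\<^sub>M bor"
proof (rule measurable_restrict_space2)
  \<comment> \<open>The time is rounded strictly upwards before the cut-off, matching the one-sided
    continuity of the orbits.\<close>
  define v where "v k u = max 0 (real_of_int (\<lfloor>u * real (Suc k)\<rfloor> + 1) / real (Suc k))" for k and u :: real
  have v_ge: "max 0 u \<le> v k u" and v_le: "v k u \<le> max 0 u + 1 / real (Suc k)" for k u
  proof -
    have "u * real (Suc k) \<le> real_of_int (\<lfloor>u * real (Suc k)\<rfloor> + 1)" by linarith
    then have "u \<le> real_of_int (\<lfloor>u * real (Suc k)\<rfloor> + 1) / real (Suc k)"
      by (subst pos_le_divide_eq) simp_all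
    then show "max 0 u \<le> v k u" unfolding v_def by (intro max.mono) simp_all
    have "real_of_int (\<lfloor>u * real (Suc k)\<rfloor> + 1) \<le> u * real (Suc k) + 1" by linarith
    then have "real_of_int (\<lfloor>u * real (Suc k)\<rfloor> + 1) / real (Suc k) \<le> (u * real (Suc k) + 1) / real (Suc k)"
      by (rule divide_right_mono) simp
    also have "\<dots> = u + 1 / real (Suc k)" by (simp add: field_simps)
    finally show "v k u \<le> max 0 u + 1 / real (Suc k)" unfolding v_def by (intro max.boundedI) auto
  qed
  have v_lim: "(\<lambda>k. v k u) \<longlonglongrightarrow> max 0 u" for u
  proof (rule tendsto_sandwich)
    show "\<forall>\<^sub>F k in sequentially. max 0 u \<le> v k u" using v_ge by (intro always_eventually allI)
    show "\<forall>\<^sub>F k in sequentially. v k u \<le> max 0 u + 1 / real (Suc k)"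
      using v_le by (intro always_eventually allI)
    show "(\<lambda>k. max 0 u + 1 / real (Suc k)) \<longlonglongrightarrow> max 0 u"
      using tendsto_add[OF tendsto_const[of "max 0 u"] LIMSEQ_inverse_real_of_nat] by (simp add: inverse_eq_divide)
  qed simp
  show "(\<lambda>z. \<theta> (max 0 (fst z)) (snd z)) \<in> borel_measurable (borel \<Otimes>\<^sub>M cbor)"
  proof (rule borel_measurable_LIMSEQ_metric[where f = "\<lambda>k z. \<theta> (v k (fst z)) (snd z)"])
    fix k
    have "(\<lambda>z. \<theta> (max 0 (real_of_int (\<lfloor>fst z * real (Suc k)\<rfloor> + 1) / real (Suc k))) (snd z))
       \<in> borel_measurable (borel \<Otimes>\<^sub>M cbor)"
    proof (rule measurable_compose_countable[where g = "\<lambda>z. \<lfloor>fst z * real (Suc k)\<rfloor>"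
          and f = "\<lambda>i z. \<theta> (max 0 (real_of_int (i + 1) / real (Suc k))) (snd z)"])
      fix i :: int
      have "\<theta> (max 0 (real_of_int (i + 1) / real (Suc k))) \<in> borel_measurable cbor"
        using flow_measurable[of "max 0 (real_of_int (i + 1) / real (Suc k))"]
        by (simp add: measurable_restrict_space2_iff)
      then show "(\<lambda>z. \<theta> (max 0 (real_of_int (i + 1) / real (Suc k))) (snd z)) \<in> borel_measurable (borel \<Otimes>\<^sub>M cbor)"
        by (rule measurable_compose[OF measurable_snd])
      show "(\<lambda>z. \<lfloor>fst z * real (Suc k)\<rfloor>) \<in> borel \<Otimes>\<^sub>M cbor \<rightarrow>\<^sub>M count_space UNIV" by measurable
    qed
    then show "(\<lambda>z. \<theta> (v k (fst z)) (snd z)) \<in> borel_measurable (borel \<Otimes>\<^sub>M cbor)"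
      by (simp add: v_def)
  next
    fix z :: "real \<times> 'a \<times> real" assume "z \<in> space (borel \<Otimes>\<^sub>M cbor)"
    then have "snd z \<in> cdom" by (auto simp: space_pair_measure space_restrict_space)
    then show "(\<lambda>k. \<theta> (v k (fst z)) (snd z)) \<longlonglongrightarrow> \<theta> (max 0 (fst z)) (snd z)"
      by (rule flow_right_continuous[OF _ _ v_ge v_lim]) simp
  qed
  show "(\<lambda>z. \<theta> (max 0 (fst z)) (snd z)) \<in> space (borel \<Otimes>\<^sub>M cbor) \<rightarrow> sdom"
    using flow_in_sdom by (auto simp: space_pair_measure space_restrict_space)
qed

lemma orbit_measurable: "p \<in> cdom \<Longrightarrow> (\<lambda>u. \<theta> (max 0 u) p) \<in> borel \<rightarrow>\<^sub>M bor"
  using measurable_compose[OF measurable_Pair2' flow_measurable_pair, of p] by (simp add: space_restrict_space)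

lemma measurable_bor_cbor: "id \<in> bor \<rightarrow>\<^sub>M cbor"
  using sdom_subset by (intro measurable_restrict_space2) (auto simp: space_restrict_space intro: measurable_restrict_space1)

lemma continuous_measurable_bor:
  assumes "continuous_on cdom (f :: 'a \<times> real \<Rightarrow> real)"
  shows "f \<in> borel_measurable bor"
  using continuous_on_subset[OF assms sdom_subset] by (rule borel_measurable_continuous_on_restrict)

text \<open>Regarded as a measure on the closed domain, although the orbit stays in the fundamental
  domain: weak limits are extracted on a compact set.\<close>

definition empirical :: "'a \<times> real \<Rightarrow> real \<Rightarrow> ('a \<times> real) measure" where
  "empirical p t = distr (uniform_measure lborel {0..t}) cbor (\<lambda>u. \<theta> (max 0 u) p)"

lemma orbit_measurable_cbor: "p \<in> cdom \<Longrightarrow> (\<lambda>u. \<theta> (max 0 u) p) \<in> uniform_measure lborel {0..t} \<rightarrow>\<^sub>M cbor"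
  using measurable_compose[OF orbit_measurable measurable_bor_cbor] by (simp cong: measurable_cong_sets)

lemma prob_space_empirical:
  assumes "p \<in> cdom" "0 < t"
  shows "prob_space (empirical p t)"
  unfolding empirical_def
  using assms by (intro prob_space.prob_space_distr orbit_measurable_cbor prob_space_uniform_measure) auto

text \<open>Bridges the gauge integral in \<open>birk_avg\<close> and the Lebesgue integral produced
  by \<open>empirical\<close>; both exist and agree since the integrand is bounded and
  Borel.\<close>

lemma orbit_lebesgue_integral:
  fixes f :: "'a \<times> real \<Rightarrow> real"
  assumes f: "continuous_on cdom f" and p: "p \<in> cdom"
  shows "(LINT u:{0..t}|lborel. f (\<theta> (max 0 u) p)) = integral {0..t} (\<lambda>u. f (\<theta> u p))"
proof -
  obtain B where B: "\<And>q. q \<in> cdom \<Longrightarrow> \<bar>f q\<bar> \<le> B" using bounded_on_cdom[OF f] by blast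
  let ?F = "\<lambda>u. f (\<theta> (max 0 u) p)"
  have F: "?F \<in> borel_measurable borel"
    by (rule measurable_compose[OF orbit_measurable[OF p] continuous_measurable_bor[OF f]])
  have "(LINT u:{0..t}|lborel. ?F u) = integral {0..t} ?F"
  proof (rule set_borel_integral_eq_integral)
    show "set_integrable lborel {0..t} ?F"
      unfolding set_integrable_def
    proof (rule integrableI_bounded_set_indicator[where B = B])
      have "\<bar>?F u\<bar> \<le> B" for u
        by (intro B subsetD[OF sdom_subset] flow_in_sdom p) simp
      then show "AE u in lborel. u \<in> {0..t} \<longrightarrow> norm (?F u) \<le> B"
        by (intro AE_I2 impI) (simp only: real_norm_def)
      show "emeasure lborel {0..t} < \<infinity>" by (cases "0 \<le> t") auto
    qed (use F in auto)
  qed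
  also have "\<dots> = integral {0..t} (\<lambda>u. f (\<theta> u p))"
    by (rule Henstock_Kurzweil_Integration.integral_cong) simp
  finally show ?thesis .
qed

lemma integral_empirical:
  assumes f: "continuous_on cdom f" and p: "p \<in> cdom" and t: "0 < t"
  shows "integral\<^sup>L (empirical p t) f = birk_avg T \<tau> f p t"
proof -
  let ?F = "\<lambda>u. f (\<theta> (max 0 u) p)"
  have F: "?F \<in> borel_measurable borel"
    by (rule measurable_compose[OF orbit_measurable[OF p] continuous_measurable_bor[OF f]])
  have "uniform_measure lborel {0..t} = density lborel (\<lambda>u. ennreal (indicator {0..t} u / t))"
    unfolding uniform_measure_def using t
    by (intro density_cong) (auto simp: indicator_def divide_ennreal simp flip: ennreal_1)
  then have "integral\<^sup>L (empirical p t) f = (\<integral>u. (indicator {0..t} u / t) *\<^sub>R ?F u \<partial>lborel)"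
    unfolding empirical_def using F t
    by (subst integral_distr[OF orbit_measurable_cbor[OF p] borel_measurable_continuous_on_restrict[OF f]])
      (simp add: integral_density)
  also have "\<dots> = (1 / t) * (LINT u:{0..t}|lborel. ?F u)"
    unfolding set_lebesgue_integral_def by (subst integral_mult_right_zero[symmetric]) (simp add: mult_ac)
  finally show ?thesis by (simp add: birk_avg_def orbit_lebesgue_integral[OF f p])
qed

text \<open>The limit on the closed domain may charge the roof, where empirical measures have no
  mass. Its image under \<open>\<theta> 0\<close> lives on the fundamental domain and has the same
  integrals of compatible functions.\<close>

theorem empirical_limit_exists:
  fixes tn :: "nat \<Rightarrow> real"
  assumes p: "p \<in> cdom" and tn: "\<And>n. 0 < tn n"
  obtains r \<nu> where "strict_mono r" "\<nu> \<in> susp_prob X \<tau>"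
    "\<And>f. susp_cont X T \<tau> f \<Longrightarrow> (\<lambda>n. birk_avg T \<tau> f p (tn (r n))) \<longlonglongrightarrow> integral\<^sup>L \<nu> f"
proof -
  obtain r \<mu> where r: "strict_mono r" and \<mu>: "sets \<mu> = sets cbor" "prob_space \<mu>"
    and lim: "\<And>f. continuous_on cdom f \<Longrightarrow> (\<lambda>n. integral\<^sup>L (empirical p (tn (r n))) f) \<longlonglongrightarrow> (integral\<^sup>L \<mu> f :: real)"
    by (rule compact_weak_limit[of cdom "\<lambda>n. empirical p (tn n)"])
      (use compact_cdom prob_space_empirical[OF p tn] in \<open>auto simp: empirical_def\<close>)
  have \<theta>_meas: "\<theta> 0 \<in> \<mu> \<rightarrow>\<^sub>M bor"
    using flow_measurable[of 0] by (simp add: measurable_cong_sets[OF \<mu>(1) refl])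
  define \<nu> where "\<nu> = distr \<mu> bor (\<theta> 0)"
  have "\<nu> \<in> susp_prob X \<tau>"
    unfolding susp_prob_def \<nu>_def using prob_space.prob_space_distr[OF \<mu>(2) \<theta>_meas] by simp
  moreover have "(\<lambda>n. birk_avg T \<tau> f p (tn (r n))) \<longlonglongrightarrow> integral\<^sup>L \<nu> f" if f: "susp_cont X T \<tau> f" for f
  proof -
    have cont: "continuous_on cdom f" using f by (simp add: susp_cont_def)
    have "space \<mu> = cdom" using sets_eq_imp_space_eq[OF \<mu>(1)] by (simp add: space_restrict_space)
    then have "integral\<^sup>L \<nu> f = integral\<^sup>L \<mu> f"
      unfolding \<nu>_def using susp_cont_flow_0[OF f]
      by (subst integral_distr[OF \<theta>_meas continuous_measurable_bor[OF cont]])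
        (auto intro!: Bochner_Integration.integral_cong)
    then show ?thesis using lim[OF cont] by (simp add: integral_empirical[OF cont p tn])
  qed
  ultimately show thesis using that r by blast
qed

text \<open>For \<open>t\<close> below \<open>roof_min\<close> at most one crossing occurs, so the
  composition is given by two continuous formulas. They agree where the roof is reached exactly, by
  the compatibility of \<open>f\<close>. Longer times are reached by iteration.\<close>

lemma susp_cont_flow:
  assumes f: "susp_cont X T \<tau> f" and t: "0 \<le> t" "t < roof_min"
  shows "susp_cont X T \<tau> (\<lambda>p. f (\<theta> t p))"
proof -
  have cont: "continuous_on cdom f" and glue: "\<And>x. x \<in> X \<Longrightarrow> f (x, \<tau> x) = f (T x, 0)"
    using f by (auto simp: susp_cont_def)
  let ?h = "\<lambda>p. snd p + t - \<tau> (fst p)"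
  have h: "continuous_on cdom ?h"
    by (intro continuous_intros continuous_on_base cont_\<tau>)
  have "continuous_on cdom (\<lambda>p. if ?h p \<le> 0 then f (fst p, snd p + t) else f (T (fst p), ?h p))"
  proof (rule continuous_on_cases_le[OF _ _ h])
    show "continuous_on {p \<in> cdom. ?h p \<le> 0} (\<lambda>p. f (fst p, snd p + t))"
      using t by (intro continuous_on_compose2[OF cont] continuous_intros) (auto simp: susp_closed_def)
    have "continuous_on {p \<in> cdom. 0 \<le> ?h p} (\<lambda>p. (T (fst p), ?h p))"
      using continuous_on_Pair[OF continuous_on_base[OF cont_T] h] by (rule continuous_on_subset) auto
    then show "continuous_on {p \<in> cdom. 0 \<le> ?h p} (\<lambda>p. f (T (fst p), ?h p))"
    proof (rule continuous_on_compose2[OF cont])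
      show "(\<lambda>p. (T (fst p), ?h p)) ` {p \<in> cdom. 0 \<le> ?h p} \<subseteq> cdom"
        using t T_X roof_min(2) by (force simp: susp_closed_def)
    qed
    show "f (fst p, snd p + t) = f (T (fst p), ?h p)" if "p \<in> cdom" "?h p = 0" for p
    proof -
      have "snd p + t = \<tau> (fst p)" "fst p \<in> X" using that by (auto simp: susp_closed_def)
      then show ?thesis using glue by simp
    qed
  qed
  moreover have "(if ?h p \<le> 0 then f (fst p, snd p + t) else f (T (fst p), ?h p)) = f (\<theta> t p)"
    if "p \<in> cdom" for p
  proof -
    obtain x s where p: "p = (x, s)" "x \<in> X" "0 \<le> s" "s \<le> \<tau> x" using \<open>p \<in> cdom\<close> by (auto simp: susp_closed_def)
    have Tx: "T x \<in> X" using p T_X by blast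
    show ?thesis
    proof (cases "s + t < \<tau> x")
      case True
      then show ?thesis using p t flow_eq[of x 0 s t] by (simp add: roof_sum_def)
    next
      case False
      have "\<theta> t (x, s) = (T x, s + t - \<tau> x)"
        using flow_eq[of x 1 s t] False p t roof_min(2)[OF Tx] by (simp add: roof_sum_def)
      then show ?thesis using p False glue by (cases "s + t = \<tau> x") auto
    qed
  qed
  ultimately have "continuous_on cdom (\<lambda>p. f (\<theta> t p))" by (simp cong: continuous_on_cong)
  then show ?thesis using flow_glue t by (simp add: susp_cont_def)
qed

text \<open>Compatible functions determine a measure on the fundamental domain: they yield the
  integrals of all continuous functions on the closed domain, these give the masses of closed sets,
  and closed sets form a generator stable under intersection.\<close>

lemma susp_prob_eqI:
  assumes \<mu>: "\<mu> \<in> susp_prob X \<tau>" and \<nu>: "\<nu> \<in> susp_prob X \<tau>"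
    and eq: "\<And>f. susp_cont X T \<tau> f \<Longrightarrow> integral\<^sup>L \<mu> f = integral\<^sup>L \<nu> f"
  shows "\<mu> = \<nu>"
proof -
  interpret \<mu>: prob_space \<mu> using \<mu> by (simp add: susp_prob_def)
  interpret \<nu>: prob_space \<nu> using \<nu> by (simp add: susp_prob_def)
  have sets: "sets \<mu> = sets bor" "sets \<nu> = sets bor" using \<mu> \<nu> by (auto simp: susp_prob_def)
  have space: "space \<mu> = sdom" "space \<nu> = sdom"
    using sets_eq_imp_space_eq[OF sets(1)] sets_eq_imp_space_eq[OF sets(2)] by (auto simp: space_restrict_space)
  text \<open>Correcting a continuous function near the roof makes it compatible with the identification
    without changing it in the limit, since the roof itself does not belong to the fundamental domain.\<close>
  have cont_eq: "integral\<^sup>L \<mu> f = integral\<^sup>L \<nu> f" if f: "continuous_on cdom f" for f :: "'a \<times> real \<Rightarrow> real"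
  proof -
    obtain B where B: "\<And>q. q \<in> cdom \<Longrightarrow> \<bar>f q\<bar> \<le> B" using bounded_on_cdom[OF f] by blast
    define \<psi> where "\<psi> k p = max 0 (1 - real k * (\<tau> (fst p) - snd p))" for k :: nat and p :: "'a \<times> real"
    define g where "g k p = (1 - \<psi> k p) * f p + \<psi> k p * f (T (fst p), 0)" for k p
    \<comment> \<open>From \<open>K\<close> on, the strip below the roof in which \<open>f\<close>
      is altered is thinner than every fibre, so \<open>g k\<close> still equals \<open>f\<close> on
      the base and the values at the roof match it.\<close>
    obtain K :: nat where K: "1 / roof_min < real K" using reals_Archimedean2 by blast
    have g_cont: "continuous_on cdom (g k)" for k
    proof -
      have "continuous_on X (\<lambda>x. f (T x, 0))"
        using T_X base_in_sdom sdom_subset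
        by (intro continuous_on_compose2[OF f] continuous_on_Pair cont_T continuous_intros) (auto simp: subset_iff)
      then show ?thesis unfolding g_def \<psi>_def
        by (intro continuous_intros f continuous_on_base[OF cont_\<tau>] continuous_on_base[of "\<lambda>x. f (T x, 0)"])
    qed
    have "g k (x, \<tau> x) = g k (T x, 0)" if "K \<le> k" "x \<in> X" for k x
    proof -
      have "1 \<le> real K * roof_min" using K roof_min(1) by (simp add: field_simps)
      also have "\<dots> \<le> real k * \<tau> (T x)"
        using that T_X roof_min by (intro mult_mono) auto
      finally show ?thesis by (simp add: g_def \<psi>_def)
    qed
    then have g: "susp_cont X T \<tau> (g (k + K))" for k using g_cont by (simp add: susp_cont_def)
    have g_lim: "(\<lambda>k. g (k + K) p) \<longlonglongrightarrow> f p" if "p \<in> sdom" for p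
    proof (rule tendsto_eventually)
      have pos: "0 < \<tau> (fst p) - snd p" using that by (auto simp: susp_dom_def)
      obtain k0 :: nat where "1 / (\<tau> (fst p) - snd p) < real k0" using reals_Archimedean2 by blast
      then have k0: "1 \<le> real k0 * (\<tau> (fst p) - snd p)" using pos by (simp add: field_simps)
      have "g (k + K) p = f p" if "k0 \<le> k" for k
      proof -
        have "real k0 * (\<tau> (fst p) - snd p) \<le> real (k + K) * (\<tau> (fst p) - snd p)"
          using pos that by (intro mult_right_mono) auto
        then have "\<psi> (k + K) p = 0" using k0 unfolding \<psi>_def by linarith
        then show ?thesis by (simp add: g_def)
      qed
      then show "\<forall>\<^sub>F k in sequentially. g (k + K) p = f p" by (auto simp: eventually_sequentially)
    qed
    have g_bound: "norm (g k p) \<le> B + B" if "p \<in> sdom" for k p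
    proof -
      have p: "p \<in> cdom" "(T (fst p), 0) \<in> cdom" "snd p \<le> \<tau> (fst p)"
        using that sdom_subset T_X base_in_sdom by (auto simp: susp_dom_def susp_closed_def less_imp_le \<tau>_pos subset_iff)
      have \<psi>: "0 \<le> \<psi> k p" "\<psi> k p \<le> 1" using p(3) by (auto simp: \<psi>_def)
      have "\<bar>(1 - \<psi> k p) * f p\<bar> \<le> 1 * B" "\<bar>\<psi> k p * f (T (fst p), 0)\<bar> \<le> 1 * B"
        unfolding abs_mult using \<psi> B[OF p(1)] B[OF p(2)] by (intro mult_mono; simp)+
      then show ?thesis by (simp add: g_def)
    qed
    have lim: "(\<lambda>k. integral\<^sup>L M (g (k + K))) \<longlonglongrightarrow> integral\<^sup>L M f"
      if M: "prob_space M" "sets M = sets bor" for M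
    proof (rule integral_dominated_convergence[where w = "\<lambda>_. B + B"])
      interpret M: prob_space M by fact
      have "space M = sdom" using sets_eq_imp_space_eq[OF M(2)] by (simp add: space_restrict_space)
      then show "AE p in M. (\<lambda>k. g (k + K) p) \<longlonglongrightarrow> f p" "AE p in M. norm (g (k + K) p) \<le> B + B" for k
        using g_lim g_bound by auto
    qed (use M continuous_measurable_bor[OF f] continuous_measurable_bor[OF g_cont]
          in \<open>auto simp: measurable_cong_sets[OF M(2) refl] prob_space.finite_measure finite_measure.integrable_const\<close>)
    have "(\<lambda>k. integral\<^sup>L \<mu> (g (k + K))) = (\<lambda>k. integral\<^sup>L \<nu> (g (k + K)))" using eq[OF g] by auto
    then show ?thesis
      using lim[OF \<mu>.prob_space_axioms sets(1)] lim[OF \<nu>.prob_space_axioms sets(2)] LIMSEQ_unique by metis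
  qed
  have closed_eq: "measure \<mu> (A \<inter> sdom) = measure \<nu> (A \<inter> sdom)" if A: "closed A" for A
  proof (cases "A = {}")
    case False
    define g where "g k p = max 0 (1 - real k * infdist p A)" for k :: nat and p :: "'a \<times> real"
    have g_cont: "continuous_on S (g k)" for k S unfolding g_def by (intro continuous_intros)
    have g_lim: "(\<lambda>k. g k p) \<longlonglongrightarrow> indicator A p" for p
    proof (cases "p \<in> A")
      case False
      then have pos: "0 < infdist p A" using A \<open>A \<noteq> {}\<close> by (intro infdist_pos_not_in_closed)
      obtain k0 :: nat where "1 / infdist p A < real k0" using reals_Archimedean2 by blast
      then have k0: "1 \<le> real k0 * infdist p A" using pos by (simp add: field_simps)
      have "g k p = 0" if "k0 \<le> k" for k
      proof -
        have "real k0 * infdist p A \<le> real k * infdist p A"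
          using pos that by (intro mult_right_mono) auto
        then show ?thesis using k0 unfolding g_def by linarith
      qed
      then have "\<forall>\<^sub>F k in sequentially. g k p = 0" by (auto simp: eventually_sequentially)
      then show ?thesis using False by (simp add: tendsto_eventually)
    qed (simp add: g_def)
    have lim: "(\<lambda>k. integral\<^sup>L M (g k)) \<longlonglongrightarrow> measure M (A \<inter> sdom)"
      if M: "prob_space M" "sets M = sets bor" for M
    proof -
      have space: "space M = sdom" using sets_eq_imp_space_eq[OF M(2)] by (simp add: space_restrict_space)
      have [measurable]: "A \<inter> sdom \<in> sets M" using A M(2) by (auto simp: sets_restrict_space)
      have "(\<lambda>k. integral\<^sup>L M (g k)) \<longlonglongrightarrow> (\<integral>p. indicator (A \<inter> sdom) p \<partial>M)"
      proof (rule integral_dominated_convergence[where w = "\<lambda>_. 1"])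
        show "AE p in M. (\<lambda>k. g k p) \<longlonglongrightarrow> indicator (A \<inter> sdom) p"
          using g_lim space by (intro AE_I2) (auto simp: indicator_inter_arith)
        show "AE p in M. norm (g k p) \<le> 1" for k
          by (intro AE_I2) (auto simp: g_def infdist_nonneg)
      qed (use M continuous_measurable_bor[OF g_cont] in \<open>auto simp: measurable_cong_sets[OF M(2) refl]
            prob_space.finite_measure finite_measure.integrable_const\<close>)
      then show ?thesis by (simp add: space Int_absorb2)
    qed
    have "(\<lambda>k. integral\<^sup>L \<mu> (g k)) = (\<lambda>k. integral\<^sup>L \<nu> (g k))" using cont_eq[OF g_cont] by auto
    then show ?thesis
      using lim[OF \<mu>.prob_space_axioms sets(1)] lim[OF \<nu>.prob_space_axioms sets(2)] LIMSEQ_unique by metis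
  qed simp
  have incl: "(\<lambda>p. p) \<in> \<mu> \<rightarrow>\<^sub>M borel" "(\<lambda>p. p) \<in> \<nu> \<rightarrow>\<^sub>M borel"
    unfolding measurable_cong_sets[OF sets(1) refl] measurable_cong_sets[OF sets(2) refl]
    by (rule measurable_restrict_space1, simp)+
  \<comment> \<open>Both measures are moved to the whole space, where the closed sets generate the
    Borel sets.\<close>
  have "distr \<mu> borel (\<lambda>p. p) = distr \<nu> borel (\<lambda>p. p)"
  proof (rule measure_eqI_generator_eq[where E = "Collect closed" and \<Omega> = UNIV and A = "\<lambda>_. UNIV"])
    show "Int_stable (Collect closed)" by (auto simp: Int_stable_def)
    fix A :: "('a \<times> real) set" assume "A \<in> Collect closed"
    then have "closed A" by simp
    then show "emeasure (distr \<mu> borel (\<lambda>p. p)) A = emeasure (distr \<nu> borel (\<lambda>p. p)) A"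
      using closed_eq[of A] by (simp add: emeasure_distr incl space \<mu>.emeasure_eq_measure \<nu>.emeasure_eq_measure)
  next
    show "sets (distr \<mu> borel (\<lambda>p. p)) = sigma_sets UNIV (Collect closed)"
      "sets (distr \<nu> borel (\<lambda>p. p)) = sigma_sets UNIV (Collect closed)"
      by (simp_all add: borel_eq_closed)
    show "emeasure (distr \<mu> borel (\<lambda>p. p)) UNIV \<noteq> \<infinity>"
      by (simp add: emeasure_distr incl \<mu>.emeasure_finite)
  qed auto
  then have *: "emeasure \<mu> (A \<inter> sdom) = emeasure \<nu> (A \<inter> sdom)" if "A \<in> sets borel" for A
    using emeasure_distr[OF incl(1) that] emeasure_distr[OF incl(2) that] by (simp add: space)
  show ?thesis
  proof (rule measure_eqI)
    fix A assume "A \<in> sets \<mu>"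
    then obtain A' where "A' \<in> sets borel" "A = A' \<inter> sdom" by (auto simp: sets sets_restrict_space)
    then show "emeasure \<mu> A = emeasure \<nu> A" using * by simp
  qed (simp add: sets)
qed

section \<open>Invariant measures\<close>

lemma susp_probD:
  assumes "\<nu> \<in> susp_prob X \<tau>"
  shows "prob_space \<nu>" "sets \<nu> = sets bor" "space \<nu> = sdom"
  using assms sets_eq_imp_space_eq[of \<nu> bor] by (auto simp: susp_prob_def space_restrict_space)

lemma flow_measurable_susp_prob:
  assumes "\<nu> \<in> susp_prob X \<tau>" "0 \<le> t"
  shows "\<theta> t \<in> \<nu> \<rightarrow>\<^sub>M bor"
  using measurable_compose[OF measurable_bor_cbor flow_measurable[OF assms(2)]]
  by (simp add: measurable_cong_sets[OF susp_probD(2)[OF assms(1)] refl])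

lemma integrable_susp_prob:
  assumes \<nu>: "\<nu> \<in> susp_prob X \<tau>" and f: "continuous_on cdom (f :: 'a \<times> real \<Rightarrow> real)"
  shows "integrable \<nu> f"
proof -
  interpret prob_space \<nu> using \<nu> by (rule susp_probD)
  obtain B where B: "\<And>q. q \<in> cdom \<Longrightarrow> \<bar>f q\<bar> \<le> B" using bounded_on_cdom[OF f] by blast
  show ?thesis
  proof (rule integrable_const_bound[where B = B])
    show "AE q in \<nu>. norm (f q) \<le> B"
      unfolding real_norm_def
      by (intro AE_I2 B subsetD[OF sdom_subset]) (simp add: susp_probD(3)[OF \<nu>])
    show "f \<in> borel_measurable \<nu>"
      using continuous_measurable_bor[OF f] by (simp add: measurable_cong_sets[OF susp_probD(2)[OF \<nu>] refl])
  qed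
qed

lemma inv_measures_iff:
  "\<nu> \<in> inv_measures X T \<tau> \<longleftrightarrow> \<nu> \<in> susp_prob X \<tau> \<and> (\<forall>t\<ge>0. distr \<nu> bor (\<theta> t) = \<nu>)"
proof (cases "\<nu> \<in> susp_prob X \<tau>")
  case True
  have "(\<forall>A\<in>sets \<nu>. emeasure \<nu> (\<theta> t -` A \<inter> space \<nu>) = emeasure \<nu> A) \<longleftrightarrow> distr \<nu> bor (\<theta> t) = \<nu>"
    if "0 \<le> t" for t
  proof
    assume *: "\<forall>A\<in>sets \<nu>. emeasure \<nu> (\<theta> t -` A \<inter> space \<nu>) = emeasure \<nu> A"
    show "distr \<nu> bor (\<theta> t) = \<nu>"
      using * by (intro measure_eqI)
        (auto simp: emeasure_distr[OF flow_measurable_susp_prob[OF True that]] susp_probD(2)[OF True])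
  next
    assume *: "distr \<nu> bor (\<theta> t) = \<nu>"
    show "\<forall>A\<in>sets \<nu>. emeasure \<nu> (\<theta> t -` A \<inter> space \<nu>) = emeasure \<nu> A"
    proof
      fix A assume "A \<in> sets \<nu>"
      then have "A \<in> sets bor" using susp_probD(2)[OF True] by simp
      then show "emeasure \<nu> (\<theta> t -` A \<inter> space \<nu>) = emeasure \<nu> A"
        using emeasure_distr[OF flow_measurable_susp_prob[OF True that]] * by metis
    qed
  qed
  then show ?thesis using True by (auto simp: inv_measures_def)
qed (simp add: inv_measures_def)

text \<open>Shifting the time window by \<open>t\<close> changes the orbit integral only on two end
  pieces of length \<open>t\<close>.\<close>

lemma birk_avg_flow:
  fixes f :: "'a \<times> real \<Rightarrow> real"
  assumes f: "continuous_on cdom f" and B: "\<And>q. q \<in> cdom \<Longrightarrow> \<bar>f q\<bar> \<le> B"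
    and p: "p \<in> cdom" and t: "0 \<le> t" and u: "0 < u"
  shows "\<bar>birk_avg T \<tau> (\<lambda>q. f (\<theta> t q)) p u - birk_avg T \<tau> f p u\<bar> \<le> 2 * B * t / u"
proof -
  let ?F = "\<lambda>v. f (\<theta> v p)"
  have "integral {0..u} (\<lambda>v. f (\<theta> t (\<theta> v p))) = integral {0..u} (?F \<circ> (+) t)"
    by (rule Henstock_Kurzweil_Integration.integral_cong) (use flow_add[OF p _ t] in \<open>simp add: add.commute\<close>)
  also have "\<dots> = integral {t..u + t} ?F" using integral_shift_Icc_real[of 0 u ?F t] by simp
  finally have *: "integral {0..u} (\<lambda>v. f (\<theta> t (\<theta> v p))) = integral {t..u + t} ?F" .
  have "integral {0..t} ?F + integral {t..u + t} ?F = integral {0..u + t} ?F"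
    "integral {0..u} ?F + integral {u..u + t} ?F = integral {0..u + t} ?F"
    using t u by (intro Henstock_Kurzweil_Integration.integral_combine orbit_integrable'[OF f p]; simp)+
  moreover have "\<bar>integral {0..t} ?F\<bar> \<le> B * t" "\<bar>integral {u..u + t} ?F\<bar> \<le> B * t"
    using orbit_integral_bound[OF f B p, of 0 t] orbit_integral_bound[OF f B p, of u "u + t"] t u by auto
  ultimately have "\<bar>integral {t..u + t} ?F - integral {0..u} ?F\<bar> \<le> 2 * B * t" by linarith
  then have "\<bar>integral {t..u + t} ?F - integral {0..u} ?F\<bar> / u \<le> 2 * B * t / u"
    using u by (intro divide_right_mono) auto
  moreover have "birk_avg T \<tau> (\<lambda>q. f (\<theta> t q)) p u - birk_avg T \<tau> f p u =
      (integral {t..u + t} ?F - integral {0..u} ?F) / u"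
    by (simp add: birk_avg_def * diff_divide_distrib)
  ultimately show ?thesis using u by (simp add: abs_divide)
qed

text \<open>For \<open>t\<close> below \<open>roof_min\<close>, composing a test function with
  \<open>\<theta> t\<close> gives another test function, so shifted averages converge too, and their
  difference from the original ones vanishes. A general time is split into equal small steps by the
  semigroup property.\<close>

theorem limit_measures_invariant:
  assumes p: "p \<in> cdom" and \<nu>: "\<nu> \<in> limit_measures X T \<tau> p"
  shows "\<nu> \<in> inv_measures X T \<tau>"
proof -
  have prob: "\<nu> \<in> susp_prob X \<tau>" using \<nu> by (simp add: limit_measures_def)
  obtain tn :: "nat \<Rightarrow> real" where tn: "filterlim tn at_top sequentially"
    and lim: "\<And>f. susp_cont X T \<tau> f \<Longrightarrow> (\<lambda>n. birk_avg T \<tau> f p (tn n)) \<longlonglongrightarrow> integral\<^sup>L \<nu> f"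
    using \<nu> by (auto simp: limit_measures_def)
  note meas = flow_measurable_susp_prob[OF prob]
  have small: "distr \<nu> bor (\<theta> t) = \<nu>" if t: "0 \<le> t" "t < roof_min" for t
  proof (rule susp_prob_eqI)
    show "distr \<nu> bor (\<theta> t) \<in> susp_prob X \<tau>"
      using prob_space.prob_space_distr[OF susp_probD(1)[OF prob] meas[OF t(1)]] by (simp add: susp_prob_def)
    fix f assume f: "susp_cont X T \<tau> f"
    then have cont: "continuous_on cdom f" by (simp add: susp_cont_def)
    obtain B where B: "\<And>q. q \<in> cdom \<Longrightarrow> \<bar>f q\<bar> \<le> B" using bounded_on_cdom[OF cont] by blast
    have "(\<lambda>n. birk_avg T \<tau> (\<lambda>q. f (\<theta> t q)) p (tn n) - birk_avg T \<tau> f p (tn n)) \<longlonglongrightarrow> 0"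
    proof (rule Lim_null_comparison)
      have "\<forall>\<^sub>F n in sequentially. 0 < tn n" using tn by (simp add: filterlim_at_top_dense)
      then show "\<forall>\<^sub>F n in sequentially. norm (birk_avg T \<tau> (\<lambda>q. f (\<theta> t q)) p (tn n) - birk_avg T \<tau> f p (tn n)) \<le> 2 * B * t / tn n"
        by eventually_elim (use birk_avg_flow[OF cont B p t(1)] in simp)
      show "(\<lambda>n. 2 * B * t / tn n) \<longlonglongrightarrow> 0"
        by (intro tendsto_divide_0[OF tendsto_const] filterlim_at_top_imp_at_infinity tn)
    qed
    moreover have "(\<lambda>n. birk_avg T \<tau> (\<lambda>q. f (\<theta> t q)) p (tn n) - birk_avg T \<tau> f p (tn n)) \<longlonglongrightarrow>
        (\<integral>q. f (\<theta> t q) \<partial>\<nu>) - integral\<^sup>L \<nu> f"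
      by (intro tendsto_diff lim f susp_cont_flow[OF f t])
    ultimately have "(\<integral>q. f (\<theta> t q) \<partial>\<nu>) - integral\<^sup>L \<nu> f = 0" by (rule LIMSEQ_unique[rotated])
    then show "integral\<^sup>L (distr \<nu> bor (\<theta> t)) f = integral\<^sup>L \<nu> f"
      by (simp add: integral_distr[OF meas[OF t(1)] continuous_measurable_bor[OF cont]])
  qed (rule prob)
  have "distr \<nu> bor (\<theta> t) = \<nu>" if "0 \<le> t" for t
  proof -
    obtain k :: nat where "t / roof_min < real k" using reals_Archimedean2 by blast
    define s where "s = t / real (Suc k)"
    have s: "0 \<le> s" "s < roof_min" "t = real (Suc k) * s"
    proof -
      have "t < real k * roof_min" using \<open>t / roof_min < real k\<close> roof_min(1) by (simp add: field_simps)
      also have "\<dots> \<le> real (Suc k) * roof_min" using roof_min(1) by simp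
      finally show "s < roof_min" by (simp add: s_def field_simps)
    qed (use \<open>0 \<le> t\<close> in \<open>simp_all add: s_def\<close>)
    have "distr \<nu> bor (\<theta> (real n * s)) = \<nu>" for n
    proof (induction n)
      case 0
      then show ?case using small[of 0] roof_min(1) by simp
    next
      case (Suc n)
      have ns: "0 \<le> real n * s" using s by simp
      have "\<theta> (real (Suc n) * s) q = (\<theta> s \<circ> \<theta> (real n * s)) q" if "q \<in> space \<nu>" for q
        using flow_add[of q "real n * s" s] that s(1) sdom_subset by (auto simp: algebra_simps susp_probD(3)[OF prob])
      then have "distr \<nu> bor (\<theta> (real (Suc n) * s)) = distr \<nu> bor (\<theta> s \<circ> \<theta> (real n * s))"
        by (intro distr_cong) auto
      also have "\<dots> = distr (distr \<nu> bor (\<theta> (real n * s))) bor (\<theta> s)"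
        using measurable_compose[OF measurable_bor_cbor flow_measurable[OF s(1)]]
        by (intro distr_distr[symmetric] meas ns) simp
      also have "\<dots> = \<nu>" using Suc small[OF s(1,2)] by simp
      finally show ?case .
    qed
    then show ?thesis unfolding s(3) .
  qed
  then show ?thesis using prob by (simp add: inv_measures_iff)
qed

text \<open>Fubini and invariance: the space average of an orbit integral up to time \<open>t\<close> is \<open>t\<close> times the
  space average of the integrand.\<close>

lemma integral_eq_0_if_bounded_orbit_integrals:
  fixes f :: "'a \<times> real \<Rightarrow> real"
  assumes \<nu>: "\<nu> \<in> inv_measures X T \<tau>" and f: "continuous_on cdom f"
    and C: "\<And>p t. p \<in> sdom \<Longrightarrow> 0 \<le> t \<Longrightarrow> \<bar>integral {0..t} (\<lambda>u. f (\<theta> u p))\<bar> \<le> C"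
  shows "integral\<^sup>L \<nu> f = 0"
proof -
  have prob: "\<nu> \<in> susp_prob X \<tau>" using \<nu> by (simp add: inv_measures_iff)
  interpret \<nu>: prob_space \<nu> using prob by (rule susp_probD)
  interpret pair_sigma_finite lborel \<nu> ..
  note f_meas = continuous_measurable_bor[OF f]
  obtain B where B: "\<And>q. q \<in> cdom \<Longrightarrow> \<bar>f q\<bar> \<le> B" using bounded_on_cdom[OF f] by blast
  have "t * \<bar>integral\<^sup>L \<nu> f\<bar> \<le> C" if t: "0 < t" for t
  proof -
    define h where "h u p = indicator {0..t} u * f (\<theta> (max 0 u) p)" for u p
    have incl: "(\<lambda>z. (fst z, snd z)) \<in> lborel \<Otimes>\<^sub>M \<nu> \<rightarrow>\<^sub>M borel \<Otimes>\<^sub>M cbor"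
    proof (rule measurable_Pair)
      show "snd \<in> lborel \<Otimes>\<^sub>M \<nu> \<rightarrow>\<^sub>M cbor"
        using measurable_compose[OF measurable_snd measurable_bor_cbor, of lborel] susp_probD(2)[OF prob]
        by (simp cong: measurable_cong_sets)
    qed simp
    have F: "(\<lambda>z. f (\<theta> (max 0 (fst z)) (snd z))) \<in> borel_measurable (lborel \<Otimes>\<^sub>M \<nu>)"
      using measurable_compose[OF incl measurable_compose[OF flow_measurable_pair f_meas]] by simp
    have "integrable (lborel \<Otimes>\<^sub>M \<nu>) (\<lambda>z. indicator ({0..t} \<times> space \<nu>) z *\<^sub>R f (\<theta> (max 0 (fst z)) (snd z)))"
    proof (rule integrableI_bounded_set_indicator[where B = B])
      show "emeasure (lborel \<Otimes>\<^sub>M \<nu>) ({0..t} \<times> space \<nu>) < \<infinity>"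
        using t by (simp add: \<nu>.emeasure_pair_measure_Times \<nu>.emeasure_space_1)
      have "\<bar>f (\<theta> (max 0 u) p)\<bar> \<le> B" if "p \<in> sdom" for u p
        by (intro B subsetD[OF sdom_subset] flow_in_sdom that) simp
      then show "AE z in lborel \<Otimes>\<^sub>M \<nu>. z \<in> {0..t} \<times> space \<nu> \<longrightarrow> norm (f (\<theta> (max 0 (fst z)) (snd z))) \<le> B"
        by (intro AE_I2) (auto simp: susp_probD(3)[OF prob] simp del: max.absorb1 max.absorb2)
    qed (use F in auto)
    also have "?this \<longleftrightarrow> integrable (lborel \<Otimes>\<^sub>M \<nu>) (case_prod h)"
      by (rule Bochner_Integration.integrable_cong)
        (auto simp: h_def space_pair_measure indicator_def split: prod.splits)
    finally have "integrable (lborel \<Otimes>\<^sub>M \<nu>) (case_prod h)" .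
    then have "(\<integral>p. (\<integral>u. h u p \<partial>lborel) \<partial>\<nu>) = (\<integral>u. (\<integral>p. h u p \<partial>\<nu>) \<partial>lborel)"
      by (rule Fubini_integral)
    moreover have "(\<integral>p. h u p \<partial>\<nu>) = indicator {0..t} u * integral\<^sup>L \<nu> f" for u
    proof -
      have "(\<integral>p. f (\<theta> (max 0 u) p) \<partial>\<nu>) = integral\<^sup>L (distr \<nu> bor (\<theta> (max 0 u))) f"
        by (rule integral_distr[symmetric, OF flow_measurable_susp_prob[OF prob] f_meas]) simp
      also have "distr \<nu> bor (\<theta> (max 0 u)) = \<nu>" using \<nu> by (simp add: inv_measures_iff)
      finally show ?thesis by (simp add: h_def)
    qed
    moreover have "(\<integral>u. indicator {0..t} u * integral\<^sup>L \<nu> f \<partial>lborel) = t * integral\<^sup>L \<nu> f"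
      using t by simp
    ultimately have eq: "t * integral\<^sup>L \<nu> f = (\<integral>p. (\<integral>u. h u p \<partial>lborel) \<partial>\<nu>)"
      by simp (use t in simp)
    have h_int: "(\<integral>u. h u p \<partial>lborel) = integral {0..t} (\<lambda>u. f (\<theta> u p))" if "p \<in> sdom" for p
      using orbit_lebesgue_integral[OF f subsetD[OF sdom_subset that], of t]
      by (simp add: set_lebesgue_integral_def h_def)
    have "\<bar>\<integral>p. (\<integral>u. h u p \<partial>lborel) \<partial>\<nu>\<bar> \<le> C"
    \<comment> \<open>In the non-integrable case the Bochner integral is 0 by convention, and the
      bound follows from \<open>C\<close> being nonnegative.\<close>
    proof (cases "integrable \<nu> (\<lambda>p. \<integral>u. h u p \<partial>lborel)")
      case True
      have "\<bar>\<integral>p. (\<integral>u. h u p \<partial>lborel) \<partial>\<nu>\<bar> \<le> (\<integral>p. \<bar>\<integral>u. h u p \<partial>lborel\<bar> \<partial>\<nu>)"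
        by (rule integral_abs_bound)
      also have "\<dots> \<le> (\<integral>p. C \<partial>\<nu>)"
        using True h_int C t by (intro integral_mono integrable_abs) (auto simp: susp_probD(3)[OF prob])
      finally show ?thesis by (simp add: \<nu>.prob_space)
    next
      case False
      obtain p where "p \<in> sdom" using X_nonempty base_in_sdom by blast
      then have "0 \<le> C" using C[of p 0] by linarith
      then show ?thesis using False by (simp add: not_integrable_integral_eq)
    qed
    then show ?thesis using t unfolding eq[symmetric] by (simp add: abs_mult)
  qed
  note bound = this
  show ?thesis
  proof (rule ccontr)
    assume "integral\<^sup>L \<nu> f \<noteq> 0"
    then have pos: "0 < \<bar>integral\<^sup>L \<nu> f\<bar>" by simp
    \<comment> \<open>The bound holds for every positive \<open>t\<close>, so a time just long
      enough contradicts a nonzero integral.\<close>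
    have "0 \<le> C" using bound[of 1] pos by linarith
    then show False using bound[of "(C + 1) / \<bar>integral\<^sup>L \<nu> f\<bar>"] pos by simp
  qed
qed

text \<open>Dividing by the fibre length undoes the weighting of the base by \<tau>. If \<nu> is the
  product of a base measure \<mu> with Lebesgue measure on the fibres, normalised to mass 1, this is
  the integral of \<open>g\<close> against \<mu> divided by the integral of \<tau>. No such
  disintegration has to be constructed.\<close>

definition base_mean :: "('a \<times> real) measure \<Rightarrow> ('a \<Rightarrow> real) \<Rightarrow> real" where
  "base_mean \<nu> g = (\<integral>p. g (fst p) / \<tau> (fst p) \<partial>\<nu>)"

lemma continuous_on_base_density:
  assumes "continuous_on X g"
  shows "continuous_on cdom (\<lambda>p. g (fst p) / \<tau> (fst p))"
proof -
  have "\<forall>x\<in>X. \<tau> x \<noteq> 0" using \<tau>_pos by fastforce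
  then show ?thesis
    by (intro continuous_on_base[of "\<lambda>x. g x / \<tau> x"] continuous_on_divide assms cont_\<tau>)
qed

text \<open>The difference of the two means is the integral of \<open>F\<close>, whose fibre
  integrals are the coboundary of \<open>g\<close>. They telescope along orbits, so the orbit
  integrals of \<open>F\<close> stay bounded.\<close>

lemma base_mean_invariant:
  assumes \<nu>: "\<nu> \<in> inv_measures X T \<tau>" and g: "continuous_on X g"
  shows "base_mean \<nu> (\<lambda>x. g (T x)) = base_mean \<nu> g"
proof -
  have prob: "\<nu> \<in> susp_prob X \<tau>" using \<nu> by (simp add: inv_measures_iff)
  have gT: "continuous_on X (\<lambda>x. g (T x))" by (rule continuous_on_compose2[OF g cont_T T_X])
  define F where "F p = (g (T (fst p)) - g (fst p)) / \<tau> (fst p)" for p :: "'a \<times> real"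
  have F: "continuous_on cdom F"
    unfolding F_def by (intro continuous_on_base_density[of "\<lambda>x. g (T x) - g x"] continuous_on_diff g gT)
  obtain B where B: "\<And>q. q \<in> cdom \<Longrightarrow> \<bar>F q\<bar> \<le> B" using bounded_on_cdom[OF F] by blast
  have "bounded (g ` X)" using compact_X g by (simp add: compact_continuous_image compact_imp_bounded)
  then obtain G where G: "\<And>x. x \<in> X \<Longrightarrow> \<bar>g x\<bar> \<le> G" by (auto simp: bounded_iff)
  have fib: "fibre_integral F x = g (T x) - g x" if "x \<in> X" for x
    using \<tau>_pos[OF that] by (simp add: fibre_integral_def F_def)
  have "\<bar>integral {0..t} (\<lambda>u. F (\<theta> u p))\<bar> \<le> 2 * B * roof_max + 2 * G" if p: "p \<in> sdom" and t: "0 \<le> t" for p t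
  proof -
    obtain x s where ps: "p = (x, s)" "x \<in> X" using p by (auto simp: susp_dom_def)
    obtain n where "\<bar>integral {0..t} (\<lambda>u. F (\<theta> u p)) - (\<Sum>i<n. fibre_integral F ((T ^^ i) x))\<bar> \<le> 2 * B * roof_max"
      using orbit_integral_approx[OF F B, of x s t] p t sdom_subset ps by blast
    moreover have "(\<Sum>i<n. fibre_integral F ((T ^^ i) x)) = (\<Sum>i<n. g ((T ^^ Suc i) x) - g ((T ^^ i) x))"
      using fib funpow_X[OF ps(2)] by simp
    moreover have "\<dots> = g ((T ^^ n) x) - g x" by (subst sum_lessThan_telescope) simp
    moreover have "\<bar>g ((T ^^ n) x)\<bar> \<le> G" "\<bar>g x\<bar> \<le> G" using G funpow_X ps(2) by auto
    ultimately show ?thesis by linarith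
  qed
  then have "integral\<^sup>L \<nu> F = 0" by (rule integral_eq_0_if_bounded_orbit_integrals[OF \<nu> F])
  moreover have "integral\<^sup>L \<nu> F = base_mean \<nu> (\<lambda>x. g (T x)) - base_mean \<nu> g"
    unfolding F_def base_mean_def diff_divide_distrib
    by (intro Bochner_Integration.integral_diff integrable_susp_prob[OF prob] continuous_on_base_density[OF g]
        continuous_on_base_density[OF gT])
  ultimately show ?thesis by simp
qed

text \<open>Replacing \<open>f\<close> by its fibre averages leaves every fibre integral unchanged,
  so orbit integrals of the difference come only from the two incomplete fibres at the ends.\<close>

lemma base_mean_fibre_integral:
  fixes f :: "'a \<times> real \<Rightarrow> real"
  assumes \<nu>: "\<nu> \<in> inv_measures X T \<tau>" and f: "continuous_on cdom f"
  shows "base_mean \<nu> (fibre_integral f) = integral\<^sup>L \<nu> f"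
proof -
  have prob: "\<nu> \<in> susp_prob X \<tau>" using \<nu> by (simp add: inv_measures_iff)
  define F where "F p = fibre_integral f (fst p) / \<tau> (fst p) - f p" for p
  note fib_cont = continuous_on_base_density[OF continuous_on_fibre_integral[OF f]]
  have F: "continuous_on cdom F" unfolding F_def by (intro continuous_on_diff f fib_cont)
  obtain B where B: "\<And>q. q \<in> cdom \<Longrightarrow> \<bar>F q\<bar> \<le> B" using bounded_on_cdom[OF F] by blast
  have fib: "fibre_integral F x = 0" if "x \<in> X" for x
  proof -
    have "fibre_integral F x = integral {0..\<tau> x} (\<lambda>_. fibre_integral f x / \<tau> x) - fibre_integral f x"
      unfolding fibre_integral_def[of F] fibre_integral_def[of f x] F_def fst_conv
      by (subst Henstock_Kurzweil_Integration.integral_diff)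
        (auto simp: fibre_integral_def intro!: integrable_continuous_interval continuous_on_fibre[OF f that])
    then show ?thesis using \<tau>_pos[OF that] by simp
  qed
  have "\<bar>integral {0..t} (\<lambda>u. F (\<theta> u p))\<bar> \<le> 2 * B * roof_max" if p: "p \<in> sdom" and t: "0 \<le> t" for p t
  proof -
    obtain x s where ps: "p = (x, s)" "x \<in> X" using p by (auto simp: susp_dom_def)
    obtain n where "\<bar>integral {0..t} (\<lambda>u. F (\<theta> u p)) - (\<Sum>i<n. fibre_integral F ((T ^^ i) x))\<bar> \<le> 2 * B * roof_max"
      using orbit_integral_approx[OF F B, of x s t] p t sdom_subset ps by blast
    then show ?thesis using fib funpow_X[OF ps(2)] by simp
  qed
  then have "integral\<^sup>L \<nu> F = 0" by (rule integral_eq_0_if_bounded_orbit_integrals[OF \<nu> F])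
  moreover have "integral\<^sup>L \<nu> F = base_mean \<nu> (fibre_integral f) - integral\<^sup>L \<nu> f"
    unfolding F_def base_mean_def
    by (intro Bochner_Integration.integral_diff integrable_susp_prob[OF prob] fib_cont f)
  ultimately show ?thesis by simp
qed

text \<open>By invariance all summands have base mean 0, so the sum cannot be positive on all of
  \<open>X\<close>. Applied to linear combinations of observables, this supplies the orbit segment
  opposing a prescribed direction.\<close>

lemma exists_nonpositive_sum:
  fixes f :: "'a \<times> real \<Rightarrow> real"
  assumes \<nu>: "\<nu> \<in> inv_measures X T \<tau>" and f: "continuous_on cdom f" and "integral\<^sup>L \<nu> f = 0"
  shows "\<exists>x\<in>X. (\<Sum>i<n. fibre_integral f ((T ^^ i) x)) \<le> 0"
proof (rule ccontr)
  assume neg: "\<not> ?thesis"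
  have prob: "\<nu> \<in> susp_prob X \<tau>" using \<nu> by (simp add: inv_measures_iff)
  interpret prob_space \<nu> using prob by (rule susp_probD)
  let ?g = "fibre_integral f"
  have cont: "continuous_on X (\<lambda>x. ?g ((T ^^ i) x))" for i
    using funpow_X by (intro continuous_on_compose2[OF continuous_on_fibre_integral[OF f]
          continuous_on_funpow[OF cont_T T_X]]) auto
  have mean_0: "base_mean \<nu> (\<lambda>x. ?g ((T ^^ i) x)) = 0" for i
  proof (induction i)
    case 0
    then show ?case using base_mean_fibre_integral[OF \<nu> f] assms(3) by simp
  next
    case (Suc i)
    then show ?case using base_mean_invariant[OF \<nu> cont[of i]] by (simp add: funpow_swap1)
  qed
  define S where "S p = (\<Sum>i<n. ?g ((T ^^ i) (fst p)) / \<tau> (fst p))" for p :: "'a \<times> real"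
  have int: "integrable \<nu> (\<lambda>p. ?g ((T ^^ i) (fst p)) / \<tau> (fst p))" for i
    by (rule integrable_susp_prob[OF prob continuous_on_base_density[OF cont]])
  have "integral\<^sup>L \<nu> S = (\<Sum>i<n. base_mean \<nu> (\<lambda>x. ?g ((T ^^ i) x)))"
    unfolding S_def base_mean_def by (rule Bochner_Integration.integral_sum[OF int])
  then have "integral\<^sup>L \<nu> S = 0" by (simp add: mean_0)
  moreover have "integral\<^sup>L \<nu> (\<lambda>_. 0) < integral\<^sup>L \<nu> S"
  proof (rule integral_less_AE_space)
    have "0 < S p" if "p \<in> sdom" for p
    proof -
      have "fst p \<in> X" using that by (auto simp: susp_dom_def)
      then have "0 < (\<Sum>i<n. ?g ((T ^^ i) (fst p))) / \<tau> (fst p)"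
        using neg \<tau>_pos by (intro divide_pos_pos) (auto simp: not_le)
      then show ?thesis by (simp add: S_def sum_divide_distrib)
    qed
    then show "AE p in \<nu>. 0 < S p" by (intro AE_I2) (simp add: susp_probD(3)[OF prob])
    show "integrable \<nu> S" unfolding S_def by (intro Bochner_Integration.integrable_sum int)
  qed (simp_all add: emeasure_space_1)
  ultimately show False by simp
qed

section \<open>From invariant measures to individual orbits\<close>

lemma birk_avg_diff_const:
  fixes f :: "'a \<times> real \<Rightarrow> real"
  assumes "continuous_on cdom f" "p \<in> cdom" "0 < t"
  shows "birk_avg T \<tau> (\<lambda>q. f q - a) p t = birk_avg T \<tau> f p t - a"
proof -
  have "integral {0..t} (\<lambda>u. f (\<theta> u p) - a) = integral {0..t} (\<lambda>u. f (\<theta> u p)) - integral {0..t} (\<lambda>_. a)"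
    by (intro Henstock_Kurzweil_Integration.integral_diff orbit_integrable'[OF assms(1,2)] integrable_const_ivl) simp
  then show ?thesis using assms(3) by (simp add: birk_avg_def diff_divide_distrib)
qed

text \<open>Up to time \<open>t\<close> an orbit from the base has at most
  \<open>t / roof_min\<close> returns, so a bound sublinear in the number of returns is sublinear in
  \<open>t\<close>.\<close>

lemma birk_avg_tendsto_0:
  fixes f :: "'a \<times> real \<Rightarrow> real"
  assumes f: "continuous_on cdom f" and z: "z \<in> X"
    and sub: "\<And>\<epsilon>. 0 < \<epsilon> \<Longrightarrow> \<exists>K. \<forall>n. \<bar>\<Sum>i<n. fibre_integral f ((T ^^ i) z)\<bar> \<le> K + \<epsilon> * real n"
  shows "((\<lambda>t. birk_avg T \<tau> f (z, 0) t) \<longlongrightarrow> 0) at_top"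
proof (rule tendstoI)
  fix e :: real assume "0 < e"
  obtain B where B: "\<And>q. q \<in> cdom \<Longrightarrow> \<bar>f q\<bar> \<le> B" using bounded_on_cdom[OF f] by blast
  \<comment> \<open>This choice turns the slope per return into slope \<open>e / 2\<close> per unit
    of time; the other half absorbs the constants once \<open>t\<close> exceeds
    \<open>t0\<close>.\<close>
  define \<epsilon> where "\<epsilon> = e * roof_min / 2"
  have "0 < \<epsilon>" using \<open>0 < e\<close> roof_min by (simp add: \<epsilon>_def)
  then obtain K where K: "\<And>n. \<bar>\<Sum>i<n. fibre_integral f ((T ^^ i) z)\<bar> \<le> K + \<epsilon> * real n" using sub by blast
  define t0 where "t0 = max 1 (2 * (2 * B * roof_max + K) / e + 1)"
  have "dist (birk_avg T \<tau> f (z, 0) t) 0 < e" if "t0 \<le> t" for t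
  proof -
    have t: "0 < t" "2 * (2 * B * roof_max + K) / e < t" using that by (auto simp: t0_def)
    have z0: "(z, 0) \<in> cdom" using base_in_sdom[OF z] sdom_subset by blast
    obtain n where n: "roof_sum n z \<le> 0 + t"
      "\<bar>integral {0..t} (\<lambda>u. f (\<theta> u (z, 0))) - (\<Sum>i<n. fibre_integral f ((T ^^ i) z))\<bar> \<le> 2 * B * roof_max"
      using orbit_integral_approx[OF f B z0, of t] t by auto
    have "real n * roof_min \<le> t" using roof_sum_ge[OF z, of n] n(1) by simp
    then have "\<epsilon> * real n \<le> e / 2 * t" using \<open>0 < e\<close> by (simp add: \<epsilon>_def mult.commute)
    then have "\<bar>integral {0..t} (\<lambda>u. f (\<theta> u (z, 0)))\<bar> \<le> 2 * B * roof_max + K + e / 2 * t"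
      using n(2) K[of n] by linarith
    also have "\<dots> < e * t" using t(2) \<open>0 < e\<close> by (simp add: field_simps)
    finally show ?thesis using t(1) by (simp add: birk_avg_def abs_mult field_simps)
  qed
  then show "\<forall>\<^sub>F t in at_top. dist (birk_avg T \<tau> f (z, 0) t) 0 < e"
    by (auto simp: eventually_at_top_linorder)
qed

text \<open>Subtracting the means reduces both limits to 0. Sublinear growth of the pair of fibre
  integrals in the plane bounds both coordinates along one and the same orbit, so one base point
  realises both means.\<close>

theorem invariant_measure_realised:
  fixes f h :: "'a \<times> real \<Rightarrow> real"
  assumes spec: "has_specification X T" and \<nu>: "\<nu> \<in> inv_measures X T \<tau>"
    and f: "continuous_on cdom f" and h: "continuous_on cdom h"
  obtains z where "z \<in> X" "((\<lambda>t. birk_avg T \<tau> f (z, 0) t) \<longlongrightarrow> integral\<^sup>L \<nu> f) at_top"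
    "((\<lambda>t. birk_avg T \<tau> h (z, 0) t) \<longlongrightarrow> integral\<^sup>L \<nu> h) at_top"
proof -
  have prob: "\<nu> \<in> susp_prob X \<tau>" using \<nu> by (simp add: inv_measures_iff)
  interpret prob_space \<nu> using prob by (rule susp_probD)
  define f' where "f' = (\<lambda>p. f p - integral\<^sup>L \<nu> f)"
  define h' where "h' = (\<lambda>p. h p - integral\<^sup>L \<nu> h)"
  have f': "continuous_on cdom f'" and h': "continuous_on cdom h'"
    unfolding f'_def h'_def by (intro continuous_intros f h)+
  have int_0: "integral\<^sup>L \<nu> f' = 0" "integral\<^sup>L \<nu> h' = 0"
    unfolding f'_def h'_def
    by (simp_all add: Bochner_Integration.integral_diff integrable_susp_prob[OF prob] f h prob_space)
  define g where "g x = (fibre_integral f' x, fibre_integral h' x)" for x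
  obtain z where z: "z \<in> X" "\<And>\<epsilon>. 0 < \<epsilon> \<Longrightarrow> \<exists>K. \<forall>n. norm (\<Sum>i<n. g ((T ^^ i) z)) \<le> K + \<epsilon> * real n"
  proof (rule specification_sublinear_sums[OF compact_X X_nonempty cont_T T_X spec])
    show "continuous_on X g"
      unfolding g_def by (intro continuous_on_Pair continuous_on_fibre_integral f' h')
    fix w :: "real \<times> real" and n
    \<comment> \<open>Testing the vector sums in direction \<open>w\<close> amounts to summing the
      fibre integrals of one scalar observable, which has mean 0 because both components do.\<close>
    let ?f = "\<lambda>p. fst w * f' p + snd w * h' p"
    have cont: "continuous_on cdom ?f" by (intro continuous_intros f' h')
    have "integral\<^sup>L \<nu> ?f = 0"
      using int_0 integrable_susp_prob[OF prob f'] integrable_susp_prob[OF prob h'] by simp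
    then obtain x where x: "x \<in> X" "(\<Sum>i<n. fibre_integral ?f ((T ^^ i) x)) \<le> 0"
      using exists_nonpositive_sum[OF \<nu> cont] by blast
    have "fibre_integral ?f y = w \<bullet> g y" if "y \<in> X" for y
      unfolding fibre_integral_def g_def inner_prod_def
      using integrable_continuous_interval[OF continuous_on_fibre[OF f' that]]
        integrable_continuous_interval[OF continuous_on_fibre[OF h' that]]
      by (subst Henstock_Kurzweil_Integration.integral_add) (auto intro: integrable_on_mult_right)
    then have "(\<Sum>i<n. fibre_integral ?f ((T ^^ i) x)) = w \<bullet> (\<Sum>i<n. g ((T ^^ i) x))"
      using funpow_X[OF x(1)] by (simp add: inner_sum_right)
    then show "\<exists>x\<in>X. w \<bullet> (\<Sum>i<n. g ((T ^^ i) x)) \<le> 0" using x by metis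
  qed blast
  have comp: "\<bar>\<Sum>i<n. fibre_integral f' ((T ^^ i) z)\<bar> \<le> norm (\<Sum>i<n. g ((T ^^ i) z))"
    "\<bar>\<Sum>i<n. fibre_integral h' ((T ^^ i) z)\<bar> \<le> norm (\<Sum>i<n. g ((T ^^ i) z))" for n
    unfolding g_def sum_prod real_norm_def[symmetric] by (rule norm_fst_le, rule norm_snd_le)
  have lim: "((\<lambda>t. birk_avg T \<tau> k (z, 0) t) \<longlongrightarrow> a) at_top"
    if k: "continuous_on cdom k" and l: "((\<lambda>t. birk_avg T \<tau> (\<lambda>q. k q - a) (z, 0) t) \<longlongrightarrow> 0) at_top" for k a
  proof -
    have z0: "(z, 0) \<in> cdom" using base_in_sdom[OF z(1)] sdom_subset by blast
    have "\<forall>\<^sub>F t in at_top. birk_avg T \<tau> (\<lambda>q. k q - a) (z, 0) t = birk_avg T \<tau> k (z, 0) t - a"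
      using eventually_gt_at_top[of 0] by eventually_elim (rule birk_avg_diff_const[OF k z0])
    with l have "((\<lambda>t. birk_avg T \<tau> k (z, 0) t - a) \<longlongrightarrow> 0) at_top" by (rule Lim_transform_eventually)
    then show ?thesis by (simp add: LIM_zero_iff)
  qed
  have sub: "\<exists>K. \<forall>n. s n \<le> K + \<epsilon> * real n"
    if s: "\<And>n. s n \<le> norm (\<Sum>i<n. g ((T ^^ i) z))" and "0 < \<epsilon>" for s :: "nat \<Rightarrow> real" and \<epsilon>
  proof -
    obtain K where "\<And>n. norm (\<Sum>i<n. g ((T ^^ i) z)) \<le> K + \<epsilon> * real n" using z(2)[OF \<open>0 < \<epsilon>\<close>] by blast
    then show ?thesis using s order_trans by blast
  qed
  have "((\<lambda>t. birk_avg T \<tau> f' (z, 0) t) \<longlongrightarrow> 0) at_top"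
    by (rule birk_avg_tendsto_0[OF f' z(1) sub[OF comp(1)]])
  moreover have "((\<lambda>t. birk_avg T \<tau> h' (z, 0) t) \<longlongrightarrow> 0) at_top"
    by (rule birk_avg_tendsto_0[OF h' z(1) sub[OF comp(2)]])
  ultimately
  show thesis using that z(1) lim f h unfolding f'_def h'_def by blast
qed

end

section \<open>Cyclic comparison of the three suprema\<close>

theorem theorem5p1:
  fixes X :: "'a::metric_space set" and T :: "'a \<Rightarrow> 'a" and \<tau> :: "'a \<Rightarrow> real"
    and \<Phi> H :: "'a \<times> real \<Rightarrow> real" and \<alpha> :: real
  assumes "compact X"
    and "\<exists>S. homeomorphism X X T S"
    and "has_specification X T"
    and "continuous_on X \<tau>" and "\<forall>x\<in>X. 0 < \<tau> x"
    and "susp_cont X T \<tau> \<Phi>" and "susp_cont X T \<tau> H"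
    and "level_set X T \<tau> \<Phi> \<alpha> \<noteq> {}"
  shows "(SUP p\<in>level_set X T \<tau> \<Phi> \<alpha>. Limsup at_top (\<lambda>t. ereal (birk_avg T \<tau> H p t)))
           = (SUP \<nu>\<in>{\<nu> \<in> inv_measures X T \<tau>. integral\<^sup>L \<nu> \<Phi> = \<alpha>}. ereal (integral\<^sup>L \<nu> H))
       \<and> (SUP \<nu>\<in>{\<nu> \<in> inv_measures X T \<tau>. integral\<^sup>L \<nu> \<Phi> = \<alpha>}. ereal (integral\<^sup>L \<nu> H))
           = (SUP \<nu>\<in>(\<Union>p\<in>level_set X T \<tau> \<Phi> \<alpha>. limit_measures X T \<tau> p). ereal (integral\<^sup>L \<nu> H))"
    (is "?A = ?B \<and> ?B = ?C")
proof -
  have "X \<noteq> {}" using assms(8) by (auto simp: level_set_def susp_dom_def)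
  then interpret roof_system X T \<tau>
    using assms by unfold_locales (auto simp: homeomorphism_def)
  have cont: "continuous_on cdom \<Phi>" "continuous_on cdom H"
    using assms(6,7) by (auto simp: susp_cont_def)
  \<comment> \<open>If the limsup at \<open>p\<close> exceeded the supremum, some real
    \<open>c\<close> would lie strictly between. Averages of \<open>H\<close> exceed
    \<open>c\<close> at arbitrarily late times; a limit measure along such times has integral at
    least \<open>c\<close>. Taking the times at least \<open>n + 1\<close> makes them positive as
    well as unbounded.\<close>
  have "?A \<le> ?C"
  proof (rule SUP_least, rule ccontr)
    fix p assume p: "p \<in> level_set X T \<tau> \<Phi> \<alpha>"
    then have p': "p \<in> cdom" using sdom_subset by (auto simp: level_set_def)
    assume "\<not> Limsup at_top (\<lambda>t. ereal (birk_avg T \<tau> H p t)) \<le> ?C"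
    then have "?C < Limsup at_top (\<lambda>t. ereal (birk_avg T \<tau> H p t))" by (simp only: not_le)
    from ereal_dense2[OF this] obtain c
      where c: "?C < ereal c" "ereal c < Limsup at_top (\<lambda>t. ereal (birk_avg T \<tau> H p t))" by (elim exE conjE)
    have "\<not> (\<forall>\<^sub>F t in at_top. ereal (birk_avg T \<tau> H p t) \<le> ereal c)"
      using Limsup_bounded[of "\<lambda>t. ereal (birk_avg T \<tau> H p t)" "ereal c" at_top] c(2) by (auto simp only: not_le[symmetric])
    then have "\<exists>t\<ge>real n + 1. c < birk_avg T \<tau> H p t" for n :: nat
      unfolding eventually_at_top_linorder by (auto simp: not_le)
    then obtain tn where tn: "\<And>n. real n + 1 \<le> tn n" "\<And>n. c < birk_avg T \<tau> H p (tn n)" by metis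
    have tn_pos: "0 < tn n" for n using tn(1)[of n] by linarith
    obtain r \<nu> where r: "strict_mono r" and \<nu>: "\<nu> \<in> susp_prob X \<tau>"
      and lim: "\<And>f. susp_cont X T \<tau> f \<Longrightarrow> (\<lambda>n. birk_avg T \<tau> f p (tn (r n))) \<longlonglongrightarrow> integral\<^sup>L \<nu> f"
      by (rule empirical_limit_exists[where tn = tn, OF p' tn_pos]) (rule that)
    have "filterlim tn at_top sequentially"
    proof (rule filterlim_at_top_mono[OF filterlim_real_sequentially])
      show "\<forall>\<^sub>F n in sequentially. real n \<le> tn n"
        using tn(1) by (intro always_eventually allI) (meson add_increasing2 order_trans le_add_same_cancel1 zero_le_one)
    qed
    then have "filterlim (\<lambda>n. tn (r n)) at_top sequentially"
      by (rule filterlim_compose[OF _ filterlim_subseq[OF r]])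
    then have "\<nu> \<in> limit_measures X T \<tau> p"
      using \<nu> lim by (auto simp: limit_measures_def intro!: exI[of _ "\<lambda>n. tn (r n)"])
    then have "ereal (integral\<^sup>L \<nu> H) \<le> ?C" using p by (intro SUP_upper) auto
    moreover have "c \<le> integral\<^sup>L \<nu> H"
      using lim[OF assms(7)] by (rule LIMSEQ_le_const) (use tn(2) in \<open>auto intro: less_imp_le\<close>)
    ultimately show False using c(1) by (meson ereal_less_eq(3) leD order_trans)
  qed
  moreover have "?C \<le> ?B"
  proof (rule SUP_subset_mono)
    show "(\<Union>p\<in>level_set X T \<tau> \<Phi> \<alpha>. limit_measures X T \<tau> p) \<subseteq> {\<nu> \<in> inv_measures X T \<tau>. integral\<^sup>L \<nu> \<Phi> = \<alpha>}"
    proof safe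
      fix p \<nu> assume p: "p \<in> level_set X T \<tau> \<Phi> \<alpha>" and \<nu>: "\<nu> \<in> limit_measures X T \<tau> p"
      have "p \<in> cdom" using p sdom_subset by (auto simp: level_set_def)
      then show "\<nu> \<in> inv_measures X T \<tau>" using \<nu> by (rule limit_measures_invariant)
      obtain tn :: "nat \<Rightarrow> real" where tn: "filterlim tn at_top sequentially"
        "(\<lambda>n. birk_avg T \<tau> \<Phi> p (tn n)) \<longlonglongrightarrow> integral\<^sup>L \<nu> \<Phi>"
        using \<nu> assms(6) by (auto simp: limit_measures_def)
      have "(\<lambda>n. birk_avg T \<tau> \<Phi> p (tn n)) \<longlonglongrightarrow> \<alpha>"
        using p by (intro filterlim_compose[OF _ tn(1)]) (simp add: level_set_def)
      then show "integral\<^sup>L \<nu> \<Phi> = \<alpha>" using tn(2) LIMSEQ_unique by blast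
    qed
  qed simp
  \<comment> \<open>The only inequality that uses specification. At the realising point
    \<open>(z, 0)\<close> the averages of \<open>H\<close> converge, so the limsup is the integral
    itself.\<close>
  moreover have "?B \<le> ?A"
  proof (rule SUP_least, clarify)
    fix \<nu> assume \<nu>: "\<nu> \<in> inv_measures X T \<tau>" and \<alpha>: "\<alpha> = integral\<^sup>L \<nu> \<Phi>"
    obtain z where z: "z \<in> X" "((\<lambda>t. birk_avg T \<tau> \<Phi> (z, 0) t) \<longlongrightarrow> integral\<^sup>L \<nu> \<Phi>) at_top"
      "((\<lambda>t. birk_avg T \<tau> H (z, 0) t) \<longlongrightarrow> integral\<^sup>L \<nu> H) at_top"
      by (rule invariant_measure_realised[OF assms(3) \<nu> cont])
    have "Limsup at_top (\<lambda>t. ereal (birk_avg T \<tau> H (z, 0) t)) = ereal (integral\<^sup>L \<nu> H)"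
      using z(3) by (intro lim_imp_Limsup) auto
    then show "ereal (integral\<^sup>L \<nu> H) \<le> (SUP p\<in>level_set X T \<tau> \<Phi> (integral\<^sup>L \<nu> \<Phi>). Limsup at_top (\<lambda>t. ereal (birk_avg T \<tau> H p t)))"
      using z(1,2) base_in_sdom by (intro SUP_upper2[of "(z, 0)"]) (auto simp: level_set_def)
  qed
  ultimately show ?thesis by auto
qed

end
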